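(* Let $\mathbf{k}$ be a commutative ring with unit, let $X$ be a connected CW-complex with $\pi=\pi_1(X)$, and let $R$ be a ring viewed as a right $\mathbf{k}\pi$-module via a ring homomorphism $\rho\colon\mathbf{k}\pi\to R$. Suppose that either $R$ is commutative, or $R=\mathbf{k}G$ and $\rho=\bar\nu$ is the linear extension of an epimorphism of groups $\nu\colon\pi\twoheadrightarrow G$. Let $J$ be the two-sided ideal of $R$ generated by $\rho(I)$, where $I$ is the augmentation ideal of $\mathbf{k}\pi$. Then the $J$-adic filtration on $H_*(X,R)$ is finer than the filtration defined by the $I$-adic spectral sequence: $$J^k\cdot H_*(X,R)\subseteq F^kH_*(X,R),\qquad\text{for all }k\ge 0.$$
   Context: $X$ is taken with a single $0$-cell. $R$ is a right $\mathbf{k}\pi$-module by $r\cdot x=r\rho(x)$. $C_\bullet(X,R)=R\otimes_{\mathbf{k}\pi}C_\bullet(\widetilde X,\mathbf{k})$, with $\widetilde X$ the universal cover, is a complex of left $R$-modules with homology $H_*(X,R)$. The $I$-adic filtration is $F^nC_\bullet(X,R)=R\cdot I^n\otimes_{\mathbf{k}\pi}C_\bullet(\widetilde X,\mathbf{k})$ (where $R\cdot I^n$ is the submodule of $R$ spanned by all $r\rho(x)$, $r\in R$, $x\in I^n$), and the spectral sequence filtration on homology is $F^nH_r(X,R)=\operatorname{im}\big(H_r(F^nC_\bullet(X,R))\to H_r(X,R)\big)$. *)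

theory Defs
  imports "HOL-Homology.Homology" "HOL-Algebra.Ideal_Product"
begin

section \<open>CW-complexes\<close>

definition closed_disk :: "nat \<Rightarrow> (nat \<Rightarrow> real) topology" where
  "closed_disk n = subtopology (Euclidean_space n) {x. (\<Sum>i<n. x i ^ 2) \<le> 1}"

definition disk_interior :: "nat \<Rightarrow> (nat \<Rightarrow> real) set" where
  "disk_interior n = {x \<in> topspace (closed_disk n). (\<Sum>i<n. x i ^ 2) < 1}"

definition disk_boundary :: "nat \<Rightarrow> (nat \<Rightarrow> real) set" where
  "disk_boundary n = {x \<in> topspace (closed_disk n). (\<Sum>i<n. x i ^ 2) = 1}"

text \<open>\<open>C n\<close> is the set of open \<open>n\<close>-cells. The third clause provides the characteristic maps and
  closure-finiteness, the last one is the weak topology.\<close>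

definition cw_complex :: "'a topology \<Rightarrow> (nat \<Rightarrow> 'a set set) \<Rightarrow> bool" where
  "cw_complex X C \<longleftrightarrow>
     Hausdorff_space X \<and>
     topspace X = (\<Union>n. \<Union>(C n)) \<and>
     (\<forall>n. \<forall>e\<in>C n. \<exists>\<Phi>.
        continuous_map (closed_disk n) X \<Phi> \<and>
        homeomorphic_map (subtopology (closed_disk n) (disk_interior n)) (subtopology X e) \<Phi> \<and>
        (\<exists>F. finite F \<and> F \<subseteq> (\<Union>m<n. C m) \<and> \<Phi> ` disk_boundary n \<subseteq> \<Union>F)) \<and>
     (\<forall>m n. \<forall>e\<in>C m. \<forall>e'\<in>C n. (m, e) \<noteq> (n, e') \<longrightarrow> e \<inter> e' = {}) \<and>
     (\<forall>A. A \<subseteq> topspace X \<and> (\<forall>n. \<forall>e\<in>C n. closedin X (A \<inter> Abstract_Topology.closure_of X e)) \<longrightarrow> closedin X A)"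

text \<open>Indexed by the integers, so that the skeleta of negative dimension are empty.\<close>

definition skeleton :: "(nat \<Rightarrow> 'a set set) \<Rightarrow> int \<Rightarrow> 'a set" where
  "skeleton C n = \<Union>{e. \<exists>m. int m \<le> n \<and> e \<in> C m}"


section \<open>Fundamental group and universal cover\<close>

definition path_homotopic :: "'a topology \<Rightarrow> (real \<Rightarrow> 'a) \<Rightarrow> (real \<Rightarrow> 'a) \<Rightarrow> bool" where
  "path_homotopic X p q \<longleftrightarrow>
     homotopic_with (\<lambda>r. r 0 = p 0 \<and> r 1 = p 1) (top_of_set {0..1}) X p q"

definition path_class :: "'a topology \<Rightarrow> (real \<Rightarrow> 'a) \<Rightarrow> (real \<Rightarrow> 'a) set" where
  "path_class X p = {q. path_homotopic X p q}"

definition path_concat :: "(real \<Rightarrow> 'a) \<Rightarrow> (real \<Rightarrow> 'a) \<Rightarrow> real \<Rightarrow> 'a" where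
  "path_concat p q = (\<lambda>t. if t \<le> 1/2 then p (2 * t) else q (2 * t - 1))"

definition class_concat ::
  "'a topology \<Rightarrow> (real \<Rightarrow> 'a) set \<Rightarrow> (real \<Rightarrow> 'a) set \<Rightarrow> (real \<Rightarrow> 'a) set" where
  "class_concat X P Q = {r. \<exists>p\<in>P. \<exists>q\<in>Q. path_homotopic X (path_concat p q) r}"

definition fundamental_group :: "'a topology \<Rightarrow> 'a \<Rightarrow> (real \<Rightarrow> 'a) set monoid" where
  "fundamental_group X x =
     \<lparr>carrier = {path_class X p | p. pathin X p \<and> p 0 = x \<and> p 1 = x},
      monoid.mult = class_concat X,
      one = path_class X (\<lambda>t. x)\<rparr>"

text \<open>The universal cover consists of the homotopy classes, relative to the end points, of the
  paths starting at the base point. The covering projection is \<open>class_end\<close>. Basic neighbourhoods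
  of a class \<open>P\<close> are obtained by prolonging \<open>P\<close> inside open neighbourhoods \<open>U\<close> of its end point.\<close>

definition cover_points :: "'a topology \<Rightarrow> 'a \<Rightarrow> (real \<Rightarrow> 'a) set set" where
  "cover_points X x = {path_class X p | p. pathin X p \<and> p 0 = x}"

definition class_end :: "(real \<Rightarrow> 'a) set \<Rightarrow> 'a" where
  "class_end P = (SOME p. p \<in> P) 1"

definition prolongations ::
  "'a topology \<Rightarrow> 'a set \<Rightarrow> (real \<Rightarrow> 'a) set \<Rightarrow> (real \<Rightarrow> 'a) set set" where
  "prolongations X U P =
     {class_concat X P (path_class X q) | q. pathin (subtopology X U) q \<and> q 0 = class_end P}"

definition universal_cover :: "'a topology \<Rightarrow> 'a \<Rightarrow> (real \<Rightarrow> 'a) set topology" where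
  "universal_cover X x =
     topology_generated_by
       {prolongations X U P | U P. openin X U \<and> P \<in> cover_points X x \<and> class_end P \<in> U}"

text \<open>The cells of the universal cover are the lifts of the cells of the base, so its skeleta are
  the preimages of the skeleta of the base.\<close>

definition cover_skeleton ::
  "'a topology \<Rightarrow> (nat \<Rightarrow> 'a set set) \<Rightarrow> 'a \<Rightarrow> int \<Rightarrow> (real \<Rightarrow> 'a) set set" where
  "cover_skeleton X C x n = {P \<in> cover_points X x. class_end P \<in> skeleton C n}"


section \<open>Group rings\<close>

definition group_ring ::
  "('k, 'm) ring_scheme \<Rightarrow> ('g, 'n) monoid_scheme \<Rightarrow> ('g \<Rightarrow> 'k) ring" where
  "group_ring K G =
     \<lparr>carrier = {a. (\<forall>g\<in>carrier G. a g \<in> carrier K) \<and> (\<forall>g. g \<notin> carrier G \<longrightarrow> a g = \<zero>\<^bsub>K\<^esub>) \<and>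
                    finite {g. a g \<noteq> \<zero>\<^bsub>K\<^esub>}},
      monoid.mult = (\<lambda>a b g. if g \<in> carrier G
         then \<Oplus>\<^bsub>K\<^esub>h\<in>{h \<in> carrier G. a h \<noteq> \<zero>\<^bsub>K\<^esub>}. a h \<otimes>\<^bsub>K\<^esub> b (inv\<^bsub>G\<^esub> h \<otimes>\<^bsub>G\<^esub> g)
         else \<zero>\<^bsub>K\<^esub>),
      one = (\<lambda>g. if g = \<one>\<^bsub>G\<^esub> then \<one>\<^bsub>K\<^esub> else \<zero>\<^bsub>K\<^esub>),
      zero = (\<lambda>g. \<zero>\<^bsub>K\<^esub>),
      add = (\<lambda>a b g. a g \<oplus>\<^bsub>K\<^esub> b g)\<rparr>"

definition augmentation ::
  "('k, 'm) ring_scheme \<Rightarrow> ('g, 'n) monoid_scheme \<Rightarrow> ('g \<Rightarrow> 'k) \<Rightarrow> 'k" where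
  "augmentation K G a = (\<Oplus>\<^bsub>K\<^esub>g\<in>{g \<in> carrier G. a g \<noteq> \<zero>\<^bsub>K\<^esub>}. a g)"

definition augmentation_ideal ::
  "('k, 'm) ring_scheme \<Rightarrow> ('g, 'n) monoid_scheme \<Rightarrow> ('g \<Rightarrow> 'k) set" where
  "augmentation_ideal K G = a_kernel (group_ring K G) K (augmentation K G)"

definition linear_extension ::
  "('k, 'm) ring_scheme \<Rightarrow> ('g, 'n) monoid_scheme \<Rightarrow> ('g \<Rightarrow> 'h) \<Rightarrow> ('g \<Rightarrow> 'k) \<Rightarrow> 'h \<Rightarrow> 'k" where
  "linear_extension K G \<nu> a h = (\<Oplus>\<^bsub>K\<^esub>g\<in>{g \<in> carrier G. a g \<noteq> \<zero>\<^bsub>K\<^esub> \<and> \<nu> g = h}. a g)"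

text \<open>The product of \<^const>\<open>ideals_set\<close> is the product of ideals, and its unit is the whole ring.\<close>

definition ideal_power :: "('r, 'm) ring_scheme \<Rightarrow> 'r set \<Rightarrow> nat \<Rightarrow> 'r set" where
  "ideal_power R I n = I [^]\<^bsub>ideals_set R\<^esub> n"


section \<open>Tensor products and homology of complexes\<close>

text \<open>Homology groups are multiplicatively written in the library, hence so are the modules here.
  Only the carrier \<open>S\<close> of the scalar ring occurs in a tensor product, and \<open>act M s x\<close>
  stands for \<open>s x\<close> if \<open>M\<close> is a left module and for \<open>x s\<close> if \<open>M\<close> is a right module.\<close>

record ('s, 'm) acted_group = "'m monoid" +
  act :: "'s \<Rightarrow> 'm \<Rightarrow> 'm"

definition with_action ::
  "('m, 'n) monoid_scheme \<Rightarrow> ('s \<Rightarrow> 'm \<Rightarrow> 'm) \<Rightarrow> ('s, 'm) acted_group" where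
  "with_action G f = \<lparr>carrier = carrier G, monoid.mult = monoid.mult G, one = \<one>\<^bsub>G\<^esub>, act = f\<rparr>"

definition int_module :: "('m, 'n) monoid_scheme \<Rightarrow> (int, 'm) acted_group" where
  "int_module G = with_action G (\<lambda>n x. x [^]\<^bsub>G\<^esub> n)"

text \<open>The map between quotient groups induced by \<open>f\<close>, the target being the quotient of \<open>G\<close>
  by \<open>H\<close>: the union below consists of a single coset when \<open>f\<close> is compatible with the quotients.\<close>

definition coset_map ::
  "('b, 'n) monoid_scheme \<Rightarrow> 'b set \<Rightarrow> ('a \<Rightarrow> 'b) \<Rightarrow> 'a set \<Rightarrow> 'b set" where
  "coset_map G H f T = (\<Union>x\<in>T. H #>\<^bsub>G\<^esub> f x)"

abbreviation tensor_free ::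
  "('s, 'm) acted_group \<Rightarrow> ('s, 'n) acted_group \<Rightarrow> ('m \<times> 'n \<Rightarrow>\<^sub>0 int) monoid" where
  "tensor_free M N \<equiv> free_Abelian_group (carrier M \<times> carrier N)"

definition tensor_relations ::
  "'s set \<Rightarrow> ('s, 'm) acted_group \<Rightarrow> ('s, 'n) acted_group \<Rightarrow> ('m \<times> 'n \<Rightarrow>\<^sub>0 int) set" where
  "tensor_relations S M N = generate (tensor_free M N)
     ({frag_of (x \<otimes>\<^bsub>M\<^esub> x', y) - frag_of (x, y) - frag_of (x', y) | x x' y.
         x \<in> carrier M \<and> x' \<in> carrier M \<and> y \<in> carrier N} \<union>
      {frag_of (x, y \<otimes>\<^bsub>N\<^esub> y') - frag_of (x, y) - frag_of (x, y') | x y y'.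
         x \<in> carrier M \<and> y \<in> carrier N \<and> y' \<in> carrier N} \<union>
      {frag_of (act M s x, y) - frag_of (x, act N s y) | s x y.
         s \<in> S \<and> x \<in> carrier M \<and> y \<in> carrier N})"

definition tensor ::
  "'s set \<Rightarrow> ('s, 'm) acted_group \<Rightarrow> ('s, 'n) acted_group \<Rightarrow> ('m \<times> 'n \<Rightarrow>\<^sub>0 int) set monoid" where
  "tensor S M N = tensor_free M N Mod tensor_relations S M N"

text \<open>The map \<open>f \<otimes> g\<close>; \<open>M\<close> and \<open>N\<close> are the factors of the target.\<close>

definition tensor_map ::
  "'s set \<Rightarrow> ('s, 'm) acted_group \<Rightarrow> ('s, 'n) acted_group \<Rightarrow> ('p \<Rightarrow> 'm) \<Rightarrow> ('q \<Rightarrow> 'n) \<Rightarrow>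
   ('p \<times> 'q \<Rightarrow>\<^sub>0 int) set \<Rightarrow> ('m \<times> 'n \<Rightarrow>\<^sub>0 int) set" where
  "tensor_map S M N f g = coset_map (tensor_free M N) (tensor_relations S M N)
     (frag_extend (\<lambda>(x, y). frag_of (f x, g y)))"

definition complex_boundaries ::
  "(int \<Rightarrow> 'a monoid) \<Rightarrow> (int \<Rightarrow> 'a \<Rightarrow> 'a) \<Rightarrow> int \<Rightarrow> 'a set" where
  "complex_boundaries T d n = d (n + 1) ` carrier (T (n + 1))"

definition complex_homology ::
  "(int \<Rightarrow> 'a monoid) \<Rightarrow> (int \<Rightarrow> 'a \<Rightarrow> 'a) \<Rightarrow> int \<Rightarrow> 'a set monoid" where
  "complex_homology T d n =
     (T n)\<lparr>carrier := kernel (T n) (T (n - 1)) (d n)\<rparr> Mod complex_boundaries T d n"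


section \<open>Cellular chains of the universal cover\<close>

type_synonym 'a cover_cell_chain = "(real \<Rightarrow> 'a) set chain set"

definition cover_chains ::
  "'a topology \<Rightarrow> (nat \<Rightarrow> 'a set set) \<Rightarrow> 'a \<Rightarrow> int \<Rightarrow> 'a cover_cell_chain monoid" where
  "cover_chains X C x n =
     relative_homology_group n
       (subtopology (universal_cover X x) (cover_skeleton X C x n)) (cover_skeleton X C x (n - 1))"

definition cover_boundary ::
  "'a topology \<Rightarrow> (nat \<Rightarrow> 'a set set) \<Rightarrow> 'a \<Rightarrow> int \<Rightarrow> 'a cover_cell_chain \<Rightarrow> 'a cover_cell_chain" where
  "cover_boundary X C x n =
     hom_relboundary n
       (subtopology (universal_cover X x) (cover_skeleton X C x n))
       (cover_skeleton X C x (n - 1)) (cover_skeleton X C x (n - 2))"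

text \<open>An element \<open>g\<close> of the fundamental group acts on the universal cover by the deck
  transformation \<open>P \<mapsto> g P\<close>, a left action since paths are concatenated from left to right.\<close>

definition cover_translate ::
  "'a topology \<Rightarrow> (nat \<Rightarrow> 'a set set) \<Rightarrow> 'a \<Rightarrow> int \<Rightarrow> (real \<Rightarrow> 'a) set \<Rightarrow>
   'a cover_cell_chain \<Rightarrow> 'a cover_cell_chain" where
  "cover_translate X C x n g =
     hom_induced n
       (subtopology (universal_cover X x) (cover_skeleton X C x n)) (cover_skeleton X C x (n - 1))
       (subtopology (universal_cover X x) (cover_skeleton X C x n)) (cover_skeleton X C x (n - 1))
       (class_concat X g)"

type_synonym ('k, 'a) cover_kchain = "('k \<times> 'a cover_cell_chain \<Rightarrow>\<^sub>0 int) set"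

definition cover_ktensor ::
  "('k, 'm) ring_scheme \<Rightarrow> 'a topology \<Rightarrow> (nat \<Rightarrow> 'a set set) \<Rightarrow> 'a \<Rightarrow> int \<Rightarrow>
   ('k, 'a) cover_kchain monoid" where
  "cover_ktensor K X C x n =
     tensor UNIV (int_module (add_monoid K)) (int_module (cover_chains X C x n))"

definition cover_ktensor_map ::
  "('k, 'm) ring_scheme \<Rightarrow> 'a topology \<Rightarrow> (nat \<Rightarrow> 'a set set) \<Rightarrow> 'a \<Rightarrow> int \<Rightarrow>
   ('k \<Rightarrow> 'k) \<Rightarrow> ('a cover_cell_chain \<Rightarrow> 'a cover_cell_chain) \<Rightarrow>
   ('k, 'a) cover_kchain \<Rightarrow> ('k, 'a) cover_kchain" where
  "cover_ktensor_map K X C x n =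
     tensor_map UNIV (int_module (add_monoid K)) (int_module (cover_chains X C x n))"

text \<open>The cellular chains with coefficients in \<open>K\<close>, as a left module over the group ring:
  \<open>(\<Sum>g. a g g) (b \<otimes> c) = (\<Sum>g. a g b \<otimes> g c)\<close>.\<close>

definition cover_kchains ::
  "('k, 'm) ring_scheme \<Rightarrow> 'a topology \<Rightarrow> (nat \<Rightarrow> 'a set set) \<Rightarrow> 'a \<Rightarrow> int \<Rightarrow>
   ((real \<Rightarrow> 'a) set \<Rightarrow> 'k, ('k, 'a) cover_kchain) acted_group" where
  "cover_kchains K X C x n =
     with_action (cover_ktensor K X C x n)
       (\<lambda>a t. \<Otimes>\<^bsub>cover_ktensor K X C x n\<^esub>g\<in>{g \<in> carrier (fundamental_group X x). a g \<noteq> \<zero>\<^bsub>K\<^esub>}.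
                cover_ktensor_map K X C x n (\<lambda>b. a g \<otimes>\<^bsub>K\<^esub> b) (cover_translate X C x n g) t)"

definition cover_kboundary ::
  "('k, 'm) ring_scheme \<Rightarrow> 'a topology \<Rightarrow> (nat \<Rightarrow> 'a set set) \<Rightarrow> 'a \<Rightarrow> int \<Rightarrow>
   ('k, 'a) cover_kchain \<Rightarrow> ('k, 'a) cover_kchain" where
  "cover_kboundary K X C x n =
     cover_ktensor_map K X C x (n - 1) (\<lambda>b. b) (cover_boundary X C x n)"


section \<open>Homology with coefficients in a ring over the group ring\<close>

abbreviation pi_ring ::
  "('k, 'm) ring_scheme \<Rightarrow> 'a topology \<Rightarrow> 'a \<Rightarrow> ((real \<Rightarrow> 'a) set \<Rightarrow> 'k) ring" where
  "pi_ring K X x \<equiv> group_ring K (fundamental_group X x)"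

text \<open>The right module structure \<open>r \<cdot> a = r \<rho>(a)\<close> on a submodule \<open>A\<close> of \<open>R\<close>.\<close>

definition right_module_via ::
  "('r, 'p) ring_scheme \<Rightarrow> ('s \<Rightarrow> 'r) \<Rightarrow> 'r set \<Rightarrow> ('s, 'r) acted_group" where
  "right_module_via R \<rho> A = with_action ((add_monoid R)\<lparr>carrier := A\<rparr>) (\<lambda>a r. r \<otimes>\<^bsub>R\<^esub> \<rho> a)"

type_synonym ('k, 'a, 'r) twisted_chain = "('r \<times> ('k, 'a) cover_kchain \<Rightarrow>\<^sub>0 int) set"

text \<open>In the following three constants the coefficients are a submodule \<open>A\<close> of the
  right module \<open>R\<close>.\<close>

definition twisted_chains ::
  "('k, 'm) ring_scheme \<Rightarrow> 'a topology \<Rightarrow> (nat \<Rightarrow> 'a set set) \<Rightarrow> 'a \<Rightarrow>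
   ('r, 'p) ring_scheme \<Rightarrow> (((real \<Rightarrow> 'a) set \<Rightarrow> 'k) \<Rightarrow> 'r) \<Rightarrow> 'r set \<Rightarrow> int \<Rightarrow>
   ('k, 'a, 'r) twisted_chain monoid" where
  "twisted_chains K X C x R \<rho> A n =
     tensor (carrier (pi_ring K X x)) (right_module_via R \<rho> A) (cover_kchains K X C x n)"

definition twisted_boundary ::
  "('k, 'm) ring_scheme \<Rightarrow> 'a topology \<Rightarrow> (nat \<Rightarrow> 'a set set) \<Rightarrow> 'a \<Rightarrow>
   ('r, 'p) ring_scheme \<Rightarrow> (((real \<Rightarrow> 'a) set \<Rightarrow> 'k) \<Rightarrow> 'r) \<Rightarrow> 'r set \<Rightarrow> int \<Rightarrow>
   ('k, 'a, 'r) twisted_chain \<Rightarrow> ('k, 'a, 'r) twisted_chain" where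
  "twisted_boundary K X C x R \<rho> A n =
     tensor_map (carrier (pi_ring K X x)) (right_module_via R \<rho> A) (cover_kchains K X C x (n - 1))
       (\<lambda>r. r) (cover_kboundary K X C x n)"

definition twisted_homology ::
  "('k, 'm) ring_scheme \<Rightarrow> 'a topology \<Rightarrow> (nat \<Rightarrow> 'a set set) \<Rightarrow> 'a \<Rightarrow>
   ('r, 'p) ring_scheme \<Rightarrow> (((real \<Rightarrow> 'a) set \<Rightarrow> 'k) \<Rightarrow> 'r) \<Rightarrow> 'r set \<Rightarrow> int \<Rightarrow>
   ('k, 'a, 'r) twisted_chain set monoid" where
  "twisted_homology K X C x R \<rho> A =
     complex_homology (twisted_chains K X C x R \<rho> A) (twisted_boundary K X C x R \<rho> A)"

text \<open>The map into the homology with coefficients in \<open>R\<close> induced by a map \<open>f\<close> of coefficients.\<close>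

definition twisted_homology_map ::
  "('k, 'm) ring_scheme \<Rightarrow> 'a topology \<Rightarrow> (nat \<Rightarrow> 'a set set) \<Rightarrow> 'a \<Rightarrow>
   ('r, 'p) ring_scheme \<Rightarrow> (((real \<Rightarrow> 'a) set \<Rightarrow> 'k) \<Rightarrow> 'r) \<Rightarrow> int \<Rightarrow> ('r \<Rightarrow> 'r) \<Rightarrow>
   ('k, 'a, 'r) twisted_chain set \<Rightarrow> ('k, 'a, 'r) twisted_chain set" where
  "twisted_homology_map K X C x R \<rho> n f =
     coset_map (twisted_chains K X C x R \<rho> (carrier R) n)
       (complex_boundaries (twisted_chains K X C x R \<rho> (carrier R))
          (twisted_boundary K X C x R \<rho> (carrier R)) n)
       (tensor_map (carrier (pi_ring K X x)) (right_module_via R \<rho> (carrier R))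
          (cover_kchains K X C x n) f (\<lambda>c. c))"


section \<open>The two filtrations\<close>

definition span_ideal_power ::
  "('k, 'm) ring_scheme \<Rightarrow> 'a topology \<Rightarrow> 'a \<Rightarrow>
   ('r, 'p) ring_scheme \<Rightarrow> (((real \<Rightarrow> 'a) set \<Rightarrow> 'k) \<Rightarrow> 'r) \<Rightarrow> nat \<Rightarrow> 'r set" where
  "span_ideal_power K X x R \<rho> k = generate (add_monoid R)
     {r \<otimes>\<^bsub>R\<^esub> \<rho> a | r a. r \<in> carrier R \<and>
        a \<in> ideal_power (pi_ring K X x) (augmentation_ideal K (fundamental_group X x)) k}"

definition I_adic_filtration ::
  "('k, 'm) ring_scheme \<Rightarrow> 'a topology \<Rightarrow> (nat \<Rightarrow> 'a set set) \<Rightarrow> 'a \<Rightarrow>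
   ('r, 'p) ring_scheme \<Rightarrow> (((real \<Rightarrow> 'a) set \<Rightarrow> 'k) \<Rightarrow> 'r) \<Rightarrow> nat \<Rightarrow> int \<Rightarrow>
   ('k, 'a, 'r) twisted_chain set set" where
  "I_adic_filtration K X C x R \<rho> k n =
     twisted_homology_map K X C x R \<rho> n (\<lambda>r. r) `
       carrier (twisted_homology K X C x R \<rho> (span_ideal_power K X x R \<rho> k) n)"

definition extended_ideal ::
  "('k, 'm) ring_scheme \<Rightarrow> 'a topology \<Rightarrow> 'a \<Rightarrow>
   ('r, 'p) ring_scheme \<Rightarrow> (((real \<Rightarrow> 'a) set \<Rightarrow> 'k) \<Rightarrow> 'r) \<Rightarrow> 'r set" where
  "extended_ideal K X x R \<rho> = Idl\<^bsub>R\<^esub> (\<rho> ` augmentation_ideal K (fundamental_group X x))"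

text \<open>A scalar \<open>r\<close> acts on the homology through left multiplication by \<open>r\<close> on the coefficients.\<close>

definition J_adic_filtration ::
  "('k, 'm) ring_scheme \<Rightarrow> 'a topology \<Rightarrow> (nat \<Rightarrow> 'a set set) \<Rightarrow> 'a \<Rightarrow>
   ('r, 'p) ring_scheme \<Rightarrow> (((real \<Rightarrow> 'a) set \<Rightarrow> 'k) \<Rightarrow> 'r) \<Rightarrow> nat \<Rightarrow> int \<Rightarrow>
   ('k, 'a, 'r) twisted_chain set set" where
  "J_adic_filtration K X C x R \<rho> k n =
     generate (twisted_homology K X C x R \<rho> (carrier R) n)
       {twisted_homology_map K X C x R \<rho> n (\<lambda>s. r \<otimes>\<^bsub>R\<^esub> s) h | r h.
          r \<in> ideal_power R (extended_ideal K X x R \<rho>) k \<and>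
          h \<in> carrier (twisted_homology K X C x R \<rho> (carrier R) n)}"

end

theory Submission
  imports Defs
begin

text \<open>Commutativity of \<open>R\<close>, or surjectivity of \<open>\<rho>\<close>, lets one write every \<open>\<rho>(a) s\<close> with \<open>a\<close> in an
  ideal \<open>L\<close> of the group ring as \<open>t \<rho>(a')\<close> with \<open>a' \<in> L\<close>. Hence \<open>R I\<^sup>k\<close> is a two-sided ideal of \<open>R\<close> and
  \<open>J\<^sup>k \<subseteq> R I\<^sup>k\<close>. Left multiplication by \<open>r \<in> J\<^sup>k\<close> is therefore a map of right modules \<open>R \<rightarrow> R I\<^sup>k\<close>,
  and the induced chain map factors the action of \<open>r\<close> on the homology through the homology
  with coefficients in \<open>R I\<^sup>k\<close>.\<close>

section \<open>Paths and deck transformations\<close>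

text \<open>For a general ring, \<open>\<rho>(I) R\<close> need not lie in
  \<open>R \<rho>(I)\<close>; then \<open>R I\<^sup>k\<close> may fail to be a right ideal and to
  contain \<open>J\<^sup>k\<close>. The rewriting is therefore asked for every ideal
  \<open>L\<close>, with \<open>a'\<close> in the same \<open>L\<close>: so it can be applied to all
  powers of \<open>I\<close>, and it yields \<open>(R L) (R L') \<subseteq> R (L L')\<close>, which
  drives the induction on \<open>k\<close>. The factorization already holds for coefficients:
  \<open>s \<mapsto> r s\<close> into \<open>R I\<^sup>k\<close>, followed by the inclusion, is
  multiplication by \<open>r\<close> on \<open>R\<close>. Functoriality of the tensor product
  carries this identity to chains and then to homology. The work on paths, deck transformations and
  group rings secures two things. The boundary is linear over the group ring, so that a map of
  coefficients induces a chain map; and the group ring is a ring with the augmentation as a ring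
  homomorphism, so that the powers of \<open>I\<close> are ideals.\<close>

lemma path_homotopicD:
  assumes "path_homotopic X p q"
  shows "pathin X p" "pathin X q" "q 0 = p 0" "q 1 = p 1"
  using homotopic_with_imp_continuous_maps[OF assms[unfolded path_homotopic_def]]
    homotopic_with_imp_property[OF assms[unfolded path_homotopic_def]]
  by (auto simp: pathin_def)

lemma path_homotopic_refl [simp]: "path_homotopic X p p \<longleftrightarrow> pathin X p"
  by (simp add: path_homotopic_def pathin_def)

lemma path_homotopic_sym: "path_homotopic X p q \<Longrightarrow> path_homotopic X q p"
  using path_homotopicD[of X p q] by (simp add: path_homotopic_def homotopic_with_sym)

lemma path_homotopic_trans: "path_homotopic X p q \<Longrightarrow> path_homotopic X q r \<Longrightarrow> path_homotopic X p r"
  using path_homotopicD(3,4)[of X p q] homotopic_with_trans[of _ _ X p q r]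
  by (simp add: path_homotopic_def)

text \<open>Linear interpolation between \<alpha> and \<beta> stays in the unit interval by
  convexity. Their common end values are arbitrary, so the associativity, unit and inverse laws all
  come from this one homotopy.\<close>

lemma path_homotopic_reparam:
  assumes p: "pathin X p"
    and cont: "continuous_on {0..1} \<alpha>" "continuous_on {0..1} \<beta>"
    and im: "\<And>t. t \<in> {0..1} \<Longrightarrow> \<alpha> t \<in> {0..1}" "\<And>t. t \<in> {0..1} \<Longrightarrow> \<beta> t \<in> {0..1}"
    and ends: "\<alpha> 0 = \<beta> 0" "\<alpha> 1 = \<beta> 1"
    and q: "\<And>t. t \<in> {0..1} \<Longrightarrow> q t = p (\<alpha> t)" and r: "\<And>t. t \<in> {0..1} \<Longrightarrow> r t = p (\<beta> t)"
  shows "path_homotopic X q r"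
proof -
  \<comment> \<open>\<open>homotopic_with\<close> prescribes the values at \<open>s = 0\<close> and
    \<open>s = 1\<close> for every real \<open>t\<close>, whereas \<open>p (\<alpha> t)\<close>
    describes \<open>q\<close> on the unit interval only; hence the separate cases.\<close>
  define h where "h = (\<lambda>(s, t). if s = 0 then q t else if s = 1 then r t else p ((1 - s) * \<alpha> t + s * \<beta> t))"
  define k where "k = (\<lambda>(s, t). (1 - s) * \<alpha> t + s * \<beta> t)"
  have top: "prod_topology (top_of_set {0..1}) (top_of_set {0..1}) = top_of_set ({0..1::real} \<times> {0..1::real})"
    by (simp add: prod_topology_subtopology_eu)
  have mem: "k (s, t) \<in> {0..1}" if "s \<in> {0..1}" "t \<in> {0..1}" for s t
  proof -
    have "(1 - s) *\<^sub>R \<alpha> t + s *\<^sub>R \<beta> t \<in> {0..1}"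
      using that im by (intro convexD) auto
    then show ?thesis by (simp add: k_def)
  qed
  have "continuous_on ({0..1} \<times> {0..1}) k"
    unfolding k_def case_prod_beta
    by (intro continuous_intros continuous_on_compose2[OF cont(1)] continuous_on_compose2[OF cont(2)]) auto
  then have "continuous_map (top_of_set ({0..1} \<times> {0..1})) (top_of_set {0..1}) k"
    using mem by auto
  then have "continuous_map (top_of_set ({0..1} \<times> {0..1})) X (p \<circ> k)"
    using p continuous_map_compose unfolding pathin_def by blast
  then have "continuous_map (top_of_set ({0..1} \<times> {0..1})) X h"
    by (rule continuous_map_eq) (auto simp: h_def k_def q r)
  then show ?thesis
    unfolding path_homotopic_def homotopic_with_def top
    by (intro exI[of _ h]) (auto simp: h_def q r ends simp flip: distrib_right)
qed

text \<open>At time 1/2 both homotopies rest at \<open>p 1 = q 0\<close>, so they glue to a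
  continuous map on the square.\<close>

lemma path_homotopic_concat:
  assumes "path_homotopic X p p'" "path_homotopic X q q'" "p 1 = q 0"
  shows "path_homotopic X (path_concat p q) (path_concat p' q')"
proof -
  let ?I = "top_of_set {0..1::real}"
  let ?J = "prod_topology ?I ?I"
  obtain h where h: "continuous_map ?J X h" "\<And>t. h (0, t) = p t" "\<And>t. h (1, t) = p' t"
    "\<And>s. s \<in> {0..1} \<Longrightarrow> h (s, 0) = p 0 \<and> h (s, 1) = p 1"
    using assms(1) unfolding path_homotopic_def homotopic_with_def by blast
  obtain k where k: "continuous_map ?J X k" "\<And>t. k (0, t) = q t" "\<And>t. k (1, t) = q' t"
    "\<And>s. s \<in> {0..1} \<Longrightarrow> k (s, 0) = q 0 \<and> k (s, 1) = q 1"
    using assms(2) unfolding path_homotopic_def homotopic_with_def by blast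
  define l where "l = (\<lambda>z. if snd z \<le> 1/2 then (h \<circ> (\<lambda>z. (fst z, 2 * snd z))) z else (k \<circ> (\<lambda>z. (fst z, 2 * snd z - 1))) z)"
  have top: "?J = top_of_set ({0..1} \<times> {0..1})"
    by (simp add: prod_topology_subtopology_eu)
  have "continuous_map ?J X l"
    unfolding l_def
  proof (rule continuous_map_cases_le)
    show "continuous_map ?J euclideanreal snd" "continuous_map ?J euclideanreal (\<lambda>z. 1/2)"
      by (auto simp: top continuous_on_snd)
    show "continuous_map (subtopology ?J {x \<in> topspace ?J. snd x \<le> 1/2}) X (h \<circ> (\<lambda>z. (fst z, 2 * snd z)))"
      by (rule continuous_map_compose[OF _ h(1)]) (auto simp: top subtopology_subtopology intro!: continuous_intros)
    show "continuous_map (subtopology ?J {x \<in> topspace ?J. 1/2 \<le> snd x}) X (k \<circ> (\<lambda>z. (fst z, 2 * snd z - 1)))"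
      by (rule continuous_map_compose[OF _ k(1)]) (auto simp: top subtopology_subtopology intro!: continuous_intros)
    show "(h \<circ> (\<lambda>z. (fst z, 2 * snd z))) z = (k \<circ> (\<lambda>z. (fst z, 2 * snd z - 1))) z"
      if "z \<in> topspace ?J" "snd z = 1/2" for z
      using that(1) h(4)[of "fst z"] k(4)[of "fst z"] assms(3) by (simp add: that(2) mem_Times_iff)
  qed
  then show ?thesis
    unfolding path_homotopic_def homotopic_with_def
    by (intro exI[of _ l]) (auto simp: l_def path_concat_def h k)
qed

lemma path_concat_ends [simp]: "path_concat p q 0 = p 0" "path_concat p q 1 = q 1"
  by (auto simp: path_concat_def)

lemma pathin_path_concat: "pathin X p \<Longrightarrow> pathin X q \<Longrightarrow> p 1 = q 0 \<Longrightarrow> pathin X (path_concat p q)"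
  using path_homotopic_concat[of X p p q q] by simp

lemma path_homotopic_concat_assoc:
  assumes "pathin X p" "pathin X q" "pathin X r" "p 1 = q 0" "q 1 = r 0"
  shows "path_homotopic X (path_concat (path_concat p q) r) (path_concat p (path_concat q r))"
\<comment> \<open>\<beta> sends the break points 1/2 and 3/4 of the right-hand path to the break
  points 1/4 and 1/2 of the left-hand one. Its slopes 1/2, 1, 2 increase, so it is the maximum of
  its linear pieces and continuity is immediate.\<close>
proof (rule path_homotopic_reparam[where \<alpha> = "\<lambda>t. t" and \<beta> = "\<lambda>t. max (t / 2) (max (t - 1/4) (2 * t - 1))"])
  show "pathin X (path_concat (path_concat p q) r)"
    using assms by (simp add: pathin_path_concat)
  show "path_concat p (path_concat q r) t =
      path_concat (path_concat p q) r (max (t / 2) (max (t - 1/4) (2 * t - 1)))" if "t \<in> {0..1}" for t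
  proof -
    consider "t \<le> 1/2" | "1/2 < t" "t \<le> 3/4" | "3/4 < t" by linarith
    then show ?thesis
    proof cases
      case 1
      then have "max (t / 2) (max (t - 1/4) (2 * t - 1)) = t / 2" by auto
      then show ?thesis using 1 by (simp add: path_concat_def)
    next
      case 2
      then have "max (t / 2) (max (t - 1/4) (2 * t - 1)) = t - 1/4" by auto
      then show ?thesis using 2 by (simp add: path_concat_def algebra_simps)
    next
      case 3
      then have "max (t / 2) (max (t - 1/4) (2 * t - 1)) = 2 * t - 1" by auto
      then show ?thesis using 3 by (simp add: path_concat_def algebra_simps)
    qed
  qed
qed (auto simp: le_max_iff_disj intro!: continuous_intros)

lemma path_homotopic_const_concat:
  assumes "pathin X p"
  shows "path_homotopic X (path_concat (\<lambda>t. p 0) p) p"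
  by (rule path_homotopic_reparam[OF assms, where \<alpha> = "\<lambda>t. max 0 (2 * t - 1)" and \<beta> = "\<lambda>t. t"])
    (auto simp: path_concat_def max_absorb1 max_absorb2 min_absorb1 min_absorb2 le_max_iff_disj intro!: continuous_intros)

text \<open>\<alpha> runs from 1 down to 0 and back while \<beta> rests at 1: the folded path
  contracts to its end point.\<close>

lemma path_homotopic_concat_reverse:
  assumes "pathin X p"
  shows "path_homotopic X (path_concat (\<lambda>t. p (1 - t)) p) (\<lambda>t. p 1)"
  by (rule path_homotopic_reparam[OF assms, where \<alpha> = "\<lambda>t. max (1 - 2 * t) (2 * t - 1)" and \<beta> = "\<lambda>t. 1"])
    (auto simp: path_concat_def max_absorb1 max_absorb2 min_absorb1 min_absorb2 le_max_iff_disj intro!: continuous_intros)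

lemma pathin_reverse:
  assumes "pathin X p"
  shows "pathin X (\<lambda>t. p (1 - t))"
proof -
  have "continuous_map (top_of_set {0..1}) (top_of_set {0..1}) (\<lambda>t::real. 1 - t)"
    by (auto intro!: continuous_intros)
  then have "continuous_map (top_of_set {0..1}) X (p \<circ> (\<lambda>t. 1 - t))"
    using assms continuous_map_compose unfolding pathin_def by blast
  then show ?thesis by (simp add: pathin_def o_def)
qed

lemma path_class_eq_iff: "pathin X p \<Longrightarrow> path_class X p = path_class X q \<longleftrightarrow> path_homotopic X p q"
  unfolding path_class_def
  by (metis (mono_tags, lifting) Collect_cong mem_Collect_eq path_homotopic_refl path_homotopic_sym path_homotopic_trans)

text \<open>\<open>class_concat\<close> runs over all representatives; since concatenation respects
  homotopy, the result is a single class.\<close>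

lemma class_concat_path_class:
  assumes "pathin X p" "pathin X q" "p 1 = q 0"
  shows "class_concat X (path_class X p) (path_class X q) = path_class X (path_concat p q)"
proof -
  have "path_homotopic X (path_concat p q) r"
    if "path_homotopic X p p'" "path_homotopic X q q'" "path_homotopic X (path_concat p' q') r" for p' q' r
    using that assms path_homotopic_concat path_homotopic_trans by blast
  moreover have "path_homotopic X p p" "path_homotopic X q q" using assms by auto
  ultimately show ?thesis
    unfolding class_concat_def path_class_def by blast
qed

lemma class_end_path_class [simp]:
  assumes "pathin X p"
  shows "class_end (path_class X p) = p 1"
proof -
  have "p \<in> path_class X p" using assms by (simp add: path_class_def)
  then have "(SOME q. q \<in> path_class X p) \<in> path_class X p" by (rule someI[of "\<lambda>q. q \<in> path_class X p"])
  then show ?thesis by (auto simp: class_end_def path_class_def dest: path_homotopicD)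
qed

lemma class_concat_assoc:
  assumes "pathin X p" "pathin X q" "pathin X r" "p 1 = q 0" "q 1 = r 0"
  shows "class_concat X (class_concat X (path_class X p) (path_class X q)) (path_class X r) =
    class_concat X (path_class X p) (class_concat X (path_class X q) (path_class X r))"
  using assms by (simp add: class_concat_path_class pathin_path_concat path_class_eq_iff path_homotopic_concat_assoc)

section \<open>The fundamental group\<close>

lemma group_fundamental_group:
  assumes "x \<in> topspace X"
  shows "group (fundamental_group X x)"
proof (rule groupI)
  let ?c = "\<lambda>t::real. x"
  have c: "pathin X ?c" using assms by (simp add: pathin_def)
  show "\<one>\<^bsub>fundamental_group X x\<^esub> \<in> carrier (fundamental_group X x)"
    using c by (auto simp: fundamental_group_def)
  show "\<one>\<^bsub>fundamental_group X x\<^esub> \<otimes>\<^bsub>fundamental_group X x\<^esub> P = P"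
    if P: "P \<in> carrier (fundamental_group X x)" for P
  proof -
    obtain p where p: "P = path_class X p" "pathin X p" "p 0 = x" "p 1 = x"
      using P by (auto simp: fundamental_group_def)
    have "path_homotopic X (path_concat ?c p) p"
      using path_homotopic_const_concat[OF p(2)] p(3) by simp
    then show ?thesis
      using p c by (simp add: fundamental_group_def class_concat_path_class path_class_eq_iff pathin_path_concat)
  qed
  show "\<exists>Q\<in>carrier (fundamental_group X x). Q \<otimes>\<^bsub>fundamental_group X x\<^esub> P = \<one>\<^bsub>fundamental_group X x\<^esub>"
    if P: "P \<in> carrier (fundamental_group X x)" for P
  proof -
    obtain p where p: "P = path_class X p" "pathin X p" "p 0 = x" "p 1 = x"
      using P by (auto simp: fundamental_group_def)
    have "path_class X (\<lambda>t. p (1 - t)) \<in> carrier (fundamental_group X x)"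
      using p pathin_reverse by (force simp: fundamental_group_def)
    moreover have "path_homotopic X (path_concat (\<lambda>t. p (1 - t)) p) ?c"
      using path_homotopic_concat_reverse[OF p(2)] p(4) by simp
    ultimately show ?thesis
      using p c pathin_reverse[OF p(2)]
      by (intro bexI[of _ "path_class X (\<lambda>t. p (1 - t))"])
        (auto simp: fundamental_group_def class_concat_path_class path_class_eq_iff pathin_path_concat)
  qed
next
  fix P Q assume "P \<in> carrier (fundamental_group X x)" "Q \<in> carrier (fundamental_group X x)"
  then obtain p q where "P = path_class X p" "pathin X p" "p 0 = x" "p 1 = x"
    "Q = path_class X q" "pathin X q" "q 0 = x" "q 1 = x"
    by (auto simp: fundamental_group_def)
  then show "P \<otimes>\<^bsub>fundamental_group X x\<^esub> Q \<in> carrier (fundamental_group X x)"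
    by (auto simp: fundamental_group_def class_concat_path_class pathin_path_concat
        intro!: exI[of _ "path_concat p q"])
next
  fix P Q S
  assume "P \<in> carrier (fundamental_group X x)" "Q \<in> carrier (fundamental_group X x)"
    "S \<in> carrier (fundamental_group X x)"
  then obtain p q r where "P = path_class X p" "pathin X p" "p 0 = x" "p 1 = x"
    "Q = path_class X q" "pathin X q" "q 0 = x" "q 1 = x"
    "S = path_class X r" "pathin X r" "r 0 = x" "r 1 = x"
    by (auto simp: fundamental_group_def)
  then show "P \<otimes>\<^bsub>fundamental_group X x\<^esub> Q \<otimes>\<^bsub>fundamental_group X x\<^esub> S =
      P \<otimes>\<^bsub>fundamental_group X x\<^esub> (Q \<otimes>\<^bsub>fundamental_group X x\<^esub> S)"
    by (simp add: fundamental_group_def class_concat_assoc)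
qed

section \<open>Deck transformations of the universal cover\<close>

text \<open>Turns group elements into points of the cover, so that facts about the cover apply to
  them too.\<close>

lemma carrier_fundamental_group:
  "carrier (fundamental_group X x) = {P \<in> cover_points X x. class_end P = x}"
  by (auto simp: fundamental_group_def cover_points_def)

lemma class_concat_cover_points:
  assumes "g \<in> carrier (fundamental_group X x)" "P \<in> cover_points X x"
  shows "class_concat X g P \<in> cover_points X x" "class_end (class_concat X g P) = class_end P"
proof -
  obtain p where p: "g = path_class X p" "pathin X p" "p 0 = x" "p 1 = x"
    using assms by (auto simp: fundamental_group_def)
  obtain q where q: "P = path_class X q" "pathin X q" "q 0 = x"
    using assms by (auto simp: cover_points_def)
  have "class_concat X g P = path_class X (path_concat p q)" "pathin X (path_concat p q)"
    using p q by (simp_all add: class_concat_path_class pathin_path_concat)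
  then show "class_concat X g P \<in> cover_points X x" "class_end (class_concat X g P) = class_end P"
    using p q by (auto simp: cover_points_def)
qed

text \<open>The group acts at the start of a path and a prolongation at its end; associativity makes
  the two commute.\<close>

lemma class_concat_action:
  assumes "g \<in> carrier (fundamental_group X x)" "P \<in> cover_points X x" "pathin X q" "q 0 = class_end P"
  shows "class_concat X (class_concat X g P) (path_class X q) =
    class_concat X g (class_concat X P (path_class X q))"
proof -
  obtain p where p: "g = path_class X p" "pathin X p" "p 0 = x" "p 1 = x"
    using assms by (auto simp: fundamental_group_def)
  obtain r where r: "P = path_class X r" "pathin X r" "r 0 = x"
    using assms by (auto simp: cover_points_def)
  show ?thesis using p r assms by (simp add: class_concat_assoc)
qed

lemma pathin_subtopologyD: "pathin (subtopology X U) q \<Longrightarrow> pathin X q"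
  by (auto simp: pathin_def continuous_map_in_subtopology)

lemma prolongations_subset:
  assumes "P \<in> cover_points X x"
  shows "prolongations X U P \<subseteq> cover_points X x"
proof
  fix Q assume "Q \<in> prolongations X U P"
  then obtain q where q: "Q = class_concat X P (path_class X q)" "pathin X q" "q 0 = class_end P"
    by (auto simp: prolongations_def dest: pathin_subtopologyD)
  obtain r where r: "P = path_class X r" "pathin X r" "r 0 = x"
    using assms by (auto simp: cover_points_def)
  show "Q \<in> cover_points X x"
    using q r by (auto simp: class_concat_path_class cover_points_def pathin_path_concat
        intro!: exI[of _ "path_concat r q"])
qed

text \<open>A deck transformation keeps end points, so it permutes the basic sets without changing
  \<open>U\<close>. Continuity rests on this.\<close>

lemma class_concat_prolongations:
  assumes g: "g \<in> carrier (fundamental_group X x)" and P: "P \<in> cover_points X x"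
  shows "class_concat X g ` prolongations X U P = prolongations X U (class_concat X g P)"
proof -
  have "class_concat X g (class_concat X P (path_class X q)) =
      class_concat X (class_concat X g P) (path_class X q)"
    if "pathin (subtopology X U) q" "q 0 = class_end P" for q
    using class_concat_action[OF g P pathin_subtopologyD] that by metis
  moreover have "class_end (class_concat X g P) = class_end P"
    using class_concat_cover_points[OF g P] by simp
  ultimately show ?thesis
    unfolding prolongations_def by (auto simp: image_iff)
qed

lemma continuous_map_deck:
  assumes x: "x \<in> topspace X" and g: "g \<in> carrier (fundamental_group X x)"
  shows "continuous_map (universal_cover X x) (universal_cover X x) (class_concat X g)"
  unfolding universal_cover_def[of X x]
proof (rule continuous_on_generated_topo, goal_cases)
  interpret P: group "fundamental_group X x" by (rule group_fundamental_group[OF x])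
  let ?S = "{prolongations X U P |U P. openin X U \<and> P \<in> cover_points X x \<and> class_end P \<in> U}"
  let ?g = "inv\<^bsub>fundamental_group X x\<^esub> g"
  note gi = P.inv_closed[OF g]
  have memI: "prolongations X U P \<in> ?S"
    if "openin X U" "P \<in> cover_points X x" "class_end P \<in> U" for U P
    unfolding mem_Collect_eq using that by (intro exI[of _ U] exI[of _ P] conjI refl)
  have memE: "y \<in> cover_points X x" if "y \<in> \<Union>?S" for y
    using that by (elim UnionE CollectE exE conjE) (use prolongations_subset in fast)
  have mult: "class_concat X h k = h \<otimes>\<^bsub>fundamental_group X x\<^esub> k" for h k
    by (simp add: fundamental_group_def)
  \<comment> \<open>Here \<open>P\<close> is a point of the cover rather than a loop, so the group
    laws cover only the product of \<open>h\<close> with its inverse; the resulting constant loop is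
    absorbed by a path homotopy.\<close>
  have cancel: "class_concat X h (class_concat X (inv\<^bsub>fundamental_group X x\<^esub> h) P) = P"
    if h: "h \<in> carrier (fundamental_group X x)" and P: "P \<in> cover_points X x" for h P
  proof -
    obtain p where p: "P = path_class X p" "pathin X p" "p 0 = x"
      using P by (auto simp: cover_points_def)
    have hi: "inv\<^bsub>fundamental_group X x\<^esub> h \<in> cover_points X x" "class_end (inv\<^bsub>fundamental_group X x\<^esub> h) = x"
      using P.inv_closed[OF h] unfolding carrier_fundamental_group by simp_all
    have "class_concat X h (class_concat X (inv\<^bsub>fundamental_group X x\<^esub> h) P) =
        class_concat X (class_concat X h (inv\<^bsub>fundamental_group X x\<^esub> h)) P"
      unfolding p(1) using class_concat_action[OF h hi(1) p(2)] hi(2) p(3) by simp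
    also have "\<dots> = class_concat X \<one>\<^bsub>fundamental_group X x\<^esub> P"
      unfolding mult using h by simp
    finally have "class_concat X h (class_concat X (inv\<^bsub>fundamental_group X x\<^esub> h) P) =
        class_concat X (path_class X (\<lambda>t. x)) (path_class X p)"
      using p(1) by (simp add: fundamental_group_def)
    moreover have "pathin X (\<lambda>t::real. x)" using x by (simp add: pathin_def)
    moreover have "path_homotopic X (path_concat (\<lambda>t. x) p) p"
      using path_homotopic_const_concat[OF p(2)] p(3) by simp
    ultimately show ?thesis
      using p by (simp add: class_concat_path_class path_class_eq_iff pathin_path_concat)
  qed
  have cancel': "class_concat X ?g (class_concat X g P) = P" if "P \<in> cover_points X x" for P
    using cancel[OF gi that] g by simp
  {
    case (1 W)
    then obtain U P where U: "W = prolongations X U P" "openin X U" "P \<in> cover_points X x" "class_end P \<in> U"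
      by blast
    let ?Q = "class_concat X ?g P"
    have Q: "?Q \<in> cover_points X x" "class_end ?Q = class_end P"
      using class_concat_cover_points[OF gi U(3)] by auto
    have img: "class_concat X g ` prolongations X U ?Q = W"
      using class_concat_prolongations[OF g Q(1)] cancel[OF g U(3)] U(1) by simp
    have img': "class_concat X ?g ` W = prolongations X U ?Q"
      using class_concat_prolongations[OF gi U(3)] U(1) by simp
    have mem: "prolongations X U ?Q \<in> ?S" by (rule memI) (simp_all add: Q U)
    \<comment> \<open>The preimage of a generator is the generator based at the translate by the
      inverse of \<open>g\<close>; \<open>img'\<close> and \<open>img\<close> give the two
      inclusions.\<close>
    have "class_concat X g -` W \<inter> \<Union>?S = prolongations X U ?Q"
    proof
      show "class_concat X g -` W \<inter> \<Union>?S \<subseteq> prolongations X U ?Q"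
      proof
        fix y assume y: "y \<in> class_concat X g -` W \<inter> \<Union>?S"
        then have "y \<in> cover_points X x" by (intro memE) simp
        then have "y = class_concat X ?g (class_concat X g y)" by (simp only: cancel')
        moreover have "class_concat X g y \<in> W" using y by simp
        ultimately show "y \<in> prolongations X U ?Q" using img' by (metis imageI)
      qed
      show "prolongations X U ?Q \<subseteq> class_concat X g -` W \<inter> \<Union>?S"
        using img Union_upper[OF mem] by (intro Int_greatest) (auto simp only: image_subset_iff_subset_vimage[symmetric])
    qed
    then show ?case
      using mem by (simp add: topology_generated_by_Basis)
  next
    case 2
    have "class_concat X g ` prolongations X U P \<subseteq> \<Union>?S"
      if "openin X U" "P \<in> cover_points X x" "class_end P \<in> U" for U P
      using class_concat_prolongations[OF g that(2)] class_concat_cover_points[OF g that(2)] that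
      by (intro Union_upper) (simp only:, intro memI, simp_all)
    then show ?case
      unfolding topology_generated_by_topspace image_Union by (intro UN_least) (elim CollectE exE conjE, simp only:)
  }
qed

section \<open>Boundary and translations of the cellular chains\<close>

lemma class_concat_cover_skeleton:
  "g \<in> carrier (fundamental_group X x) \<Longrightarrow>
    class_concat X g \<in> cover_skeleton X C x n \<rightarrow> cover_skeleton X C x n"
  by (auto simp: cover_skeleton_def class_concat_cover_points)

lemma cover_skeleton_mono: "m \<le> n \<Longrightarrow> cover_skeleton X C x m \<subseteq> cover_skeleton X C x n"
  unfolding cover_skeleton_def skeleton_def by force

text \<open>The boundary map of a triple ends in a group formed from an iterated subspace; this
  identifies that group with \<open>cover_chains\<close> one degree lower.\<close>

lemma subtopology_cover_skeleton:
  "subtopology (subtopology (universal_cover X x) (cover_skeleton X C x n)) (cover_skeleton X C x (n - 1)) =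
    subtopology (universal_cover X x) (cover_skeleton X C x (n - 1))"
  using cover_skeleton_mono[of "n - 1" n X C x] by (simp add: subtopology_subtopology Int_absorb1)

lemma cover_boundary_hom: "cover_boundary X C x n \<in> hom (cover_chains X C x n) (cover_chains X C x (n - 1))"
proof -
  \<comment> \<open>In degree \<open>n - 1\<close>, \<open>cover_chains\<close> mentions
    \<open>n - 1 - 1\<close>, while \<open>cover_boundary\<close> mentions
    \<open>n - 2\<close>.\<close>
  have "n - 1 - 1 = n - 2" by simp
  then show ?thesis
    using group_homomorphism_hom_relboundary[of n "subtopology (universal_cover X x) (cover_skeleton X C x n)"
        "cover_skeleton X C x (n - 1)" "cover_skeleton X C x (n - 2)"]
    unfolding cover_boundary_def cover_chains_def subtopology_cover_skeleton by (simp only:)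
qed

lemma cover_translate_hom: "cover_translate X C x n g \<in> hom (cover_chains X C x n) (cover_chains X C x n)"
  unfolding cover_translate_def cover_chains_def by (rule hom_induced_hom)

text \<open>The boundary is the connecting map of the triple of skeleta of dimensions
  \<open>n\<close>, \<open>n - 1\<close>, \<open>n - 2\<close>. A deck transformation is a
  continuous map of this triple into itself, so naturality applies.\<close>

lemma cover_boundary_translate:
  assumes "x \<in> topspace X" "g \<in> carrier (fundamental_group X x)"
  shows "cover_boundary X C x n (cover_translate X C x n g c) =
    cover_translate X C x (n - 1) g (cover_boundary X C x n c)"
proof -
  let ?S = "\<lambda>n. cover_skeleton X C x n"
  let ?U = "\<lambda>n. subtopology (universal_cover X x) (?S n)"
  have "continuous_map (?U n) (?U n) (class_concat X g)"
    using continuous_map_deck[OF assms] class_concat_cover_skeleton[OF assms(2), of C n]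
    by (intro continuous_map_into_subtopology continuous_map_from_subtopology) auto
  note * = naturality_hom_induced_relboundary[OF this class_concat_cover_skeleton[OF assms(2), of C "n - 1"]
      class_concat_cover_skeleton[OF assms(2), of C "n - 2"], of n, unfolded subtopology_cover_skeleton]
  have "n - 1 - 1 = n - 2" by simp
  then show ?thesis
    using fun_cong[OF *, of c] unfolding cover_boundary_def cover_translate_def o_apply by (simp only:)
qed


section \<open>Group rings and extensions of ideals\<close>

locale group_algebra = K: cring K + G: group G
  for K :: "('k, 'm) ring_scheme" and G :: "('g, 'n) monoid_scheme"
begin

abbreviation "A \<equiv> group_ring K G"

definition monomial :: "'k \<Rightarrow> 'g \<Rightarrow> 'g \<Rightarrow> 'k" where
  "monomial k g = (\<lambda>h. if h = g then k else \<zero>\<^bsub>K\<^esub>)"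

lemma carrier_iff:
  "a \<in> carrier A \<longleftrightarrow> (\<forall>g\<in>carrier G. a g \<in> carrier K) \<and> (\<forall>g. g \<notin> carrier G \<longrightarrow> a g = \<zero>\<^bsub>K\<^esub>) \<and>
     finite {g. a g \<noteq> \<zero>\<^bsub>K\<^esub>}"
  by (simp add: group_ring_def)

lemma coeff_closed: "a \<in> carrier A \<Longrightarrow> a g \<in> carrier K"
  using carrier_iff by (cases "g \<in> carrier G") auto

lemma supportE:
  assumes "a \<in> carrier A"
  obtains F where "finite F" "F \<subseteq> carrier G" "\<And>g. g \<notin> F \<Longrightarrow> a g = \<zero>\<^bsub>K\<^esub>"
proof
  show "finite {g. a g \<noteq> \<zero>\<^bsub>K\<^esub>}" "{g. a g \<noteq> \<zero>\<^bsub>K\<^esub>} \<subseteq> carrier G"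
    using assms by (auto simp: carrier_iff)
qed auto

lemma carrierI:
  assumes "\<And>g. g \<in> carrier G \<Longrightarrow> a g \<in> carrier K" "finite F" "F \<subseteq> carrier G" "\<And>g. g \<notin> F \<Longrightarrow> a g = \<zero>\<^bsub>K\<^esub>"
  shows "a \<in> carrier A"
proof -
  have "{g. a g \<noteq> \<zero>\<^bsub>K\<^esub>} \<subseteq> F" using assms(4) by blast
  then show ?thesis
    unfolding carrier_iff using assms finite_subset by blast
qed

text \<open>The operations on group rings sum over exact supports, which change under addition. Any
  finite set containing the support may be used instead, so several elements can share one index
  set; \<open>P\<close> accommodates the fibre condition of \<open>linear_extension\<close>.\<close>

lemma finsum_support:
  assumes "a \<in> carrier A" "finite F" "F \<subseteq> carrier G" "\<And>g. g \<notin> F \<Longrightarrow> a g = \<zero>\<^bsub>K\<^esub>"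
    and "\<And>g. g \<in> carrier G \<Longrightarrow> f g \<in> carrier K" "\<And>g. a g = \<zero>\<^bsub>K\<^esub> \<Longrightarrow> f g = \<zero>\<^bsub>K\<^esub>"
  shows "(\<Oplus>\<^bsub>K\<^esub>g\<in>{g \<in> carrier G. a g \<noteq> \<zero>\<^bsub>K\<^esub> \<and> P g}. f g) = (\<Oplus>\<^bsub>K\<^esub>g\<in>{g \<in> F. P g}. f g)"
  by (rule K.add.finprod_mono_neutral_cong_left) (use assms in auto)

lemma mult_eq:
  assumes a: "a \<in> carrier A" and b: "b \<in> carrier A"
    and F: "finite F" "F \<subseteq> carrier G" "\<And>g. g \<notin> F \<Longrightarrow> a g = \<zero>\<^bsub>K\<^esub>"
    and g: "g \<in> carrier G"
  shows "(a \<otimes>\<^bsub>A\<^esub> b) g = (\<Oplus>\<^bsub>K\<^esub>h\<in>F. a h \<otimes>\<^bsub>K\<^esub> b (inv\<^bsub>G\<^esub> h \<otimes>\<^bsub>G\<^esub> g))"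
  using finsum_support[OF a F, of "\<lambda>h. a h \<otimes>\<^bsub>K\<^esub> b (inv\<^bsub>G\<^esub> h \<otimes>\<^bsub>G\<^esub> g)" "\<lambda>_. True"] g coeff_closed[OF a] coeff_closed[OF b]
  by (simp add: group_ring_def)

lemma mult_outside: "g \<notin> carrier G \<Longrightarrow> (a \<otimes>\<^bsub>A\<^esub> b) g = \<zero>\<^bsub>K\<^esub>"
  by (simp add: group_ring_def)

lemma add_eq: "a \<oplus>\<^bsub>A\<^esub> b = (\<lambda>g. a g \<oplus>\<^bsub>K\<^esub> b g)"
  by (simp add: group_ring_def)

lemma one_eq: "\<one>\<^bsub>A\<^esub> = monomial \<one>\<^bsub>K\<^esub> \<one>\<^bsub>G\<^esub>"
  by (simp add: group_ring_def monomial_def)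

lemma zero_eq: "\<zero>\<^bsub>A\<^esub> = (\<lambda>g. \<zero>\<^bsub>K\<^esub>)"
  by (simp add: group_ring_def)

lemma monomial_closed: "k \<in> carrier K \<Longrightarrow> g \<in> carrier G \<Longrightarrow> monomial k g \<in> carrier A"
  by (rule carrierI[of _ "{g}"]) (auto simp: monomial_def)

lemma add_closed:
  assumes "a \<in> carrier A" "b \<in> carrier A"
  shows "a \<oplus>\<^bsub>A\<^esub> b \<in> carrier A"
proof -
  obtain F where "finite F" "F \<subseteq> carrier G" "\<And>g. g \<notin> F \<Longrightarrow> a g = \<zero>\<^bsub>K\<^esub>"
    using supportE[OF assms(1)] by blast
  moreover obtain F' where "finite F'" "F' \<subseteq> carrier G" "\<And>g. g \<notin> F' \<Longrightarrow> b g = \<zero>\<^bsub>K\<^esub>"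
    using supportE[OF assms(2)] by blast
  ultimately show ?thesis
    using coeff_closed[OF assms(1)] coeff_closed[OF assms(2)]
    by (intro carrierI[of _ "F \<union> F'"]) (auto simp: add_eq)
qed

lemma mult_closed:
  assumes a: "a \<in> carrier A" and b: "b \<in> carrier A"
  shows "a \<otimes>\<^bsub>A\<^esub> b \<in> carrier A"
proof -
  obtain F where F: "finite F" "F \<subseteq> carrier G" "\<And>g. g \<notin> F \<Longrightarrow> a g = \<zero>\<^bsub>K\<^esub>"
    using supportE[OF a] by blast
  obtain F' where F': "finite F'" "F' \<subseteq> carrier G" "\<And>g. g \<notin> F' \<Longrightarrow> b g = \<zero>\<^bsub>K\<^esub>"
    using supportE[OF b] by blast
  \<comment> \<open>If \<open>h\<close> lies in \<open>F\<close> and \<open>g\<close> is not a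
    product of elements of \<open>F\<close> and \<open>F'\<close>, then \<open>b\<close> vanishes at
    \<open>h\<close> inverse times \<open>g\<close>, and so does every summand.\<close>
  let ?S = "(\<lambda>(h, k). h \<otimes>\<^bsub>G\<^esub> k) ` (F \<times> F')"
  note closed = coeff_closed[OF a] coeff_closed[OF b]
  have eq: "(a \<otimes>\<^bsub>A\<^esub> b) g = (\<Oplus>\<^bsub>K\<^esub>h\<in>F. a h \<otimes>\<^bsub>K\<^esub> b (inv\<^bsub>G\<^esub> h \<otimes>\<^bsub>G\<^esub> g))"
    if "g \<in> carrier G" for g
    by (rule mult_eq[OF a b F that])
  show ?thesis
  proof (rule carrierI[of _ ?S])
    show "(a \<otimes>\<^bsub>A\<^esub> b) g \<in> carrier K" if "g \<in> carrier G" for g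
      unfolding eq[OF that] using closed by (intro K.finsum_closed) auto
    show "(a \<otimes>\<^bsub>A\<^esub> b) g = \<zero>\<^bsub>K\<^esub>" if "g \<notin> ?S" for g
    proof (cases "g \<in> carrier G")
      case True
      have "a h \<otimes>\<^bsub>K\<^esub> b (inv\<^bsub>G\<^esub> h \<otimes>\<^bsub>G\<^esub> g) = \<zero>\<^bsub>K\<^esub>" if h: "h \<in> F" for h
      proof -
        have "h \<in> carrier G" using h F(2) by blast
        then have "g = h \<otimes>\<^bsub>G\<^esub> (inv\<^bsub>G\<^esub> h \<otimes>\<^bsub>G\<^esub> g)"
          using True by (simp flip: G.m_assoc)
        then have "inv\<^bsub>G\<^esub> h \<otimes>\<^bsub>G\<^esub> g \<notin> F'"
          using h \<open>g \<notin> ?S\<close> by (metis (mono_tags, lifting) SigmaI case_prod_conv image_eqI)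
        then show ?thesis using F'(3) closed by simp
      qed
      then show ?thesis
        unfolding eq[OF True] by (intro K.add.finprod_one_eqI) auto
    qed (simp add: mult_outside)
  qed (use F F' in auto)
qed

lemma abelian_group_group_ring: "abelian_group A"
proof (rule abelian_groupI)
  fix a assume a: "a \<in> carrier A"
  then obtain F where F: "finite F" "F \<subseteq> carrier G" "\<And>g. g \<notin> F \<Longrightarrow> a g = \<zero>\<^bsub>K\<^esub>"
    using supportE by blast
  have "(\<lambda>g. \<ominus>\<^bsub>K\<^esub> a g) \<in> carrier A"
    by (rule carrierI[OF _ F(1,2)]) (auto simp: F(3) coeff_closed[OF a])
  then show "\<exists>b\<in>carrier A. b \<oplus>\<^bsub>A\<^esub> a = \<zero>\<^bsub>A\<^esub>"
    by (rule bexI[rotated]) (simp add: add_eq zero_eq coeff_closed[OF a] K.l_neg)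
  show "\<zero>\<^bsub>A\<^esub> \<oplus>\<^bsub>A\<^esub> a = a"
    by (simp add: add_eq zero_eq coeff_closed[OF a])
next
  show "\<zero>\<^bsub>A\<^esub> \<in> carrier A" by (simp add: zero_eq carrier_iff)
qed (simp_all add: add_closed, simp_all add: add_eq coeff_closed K.a_ac)

lemma monomial_mult:
  assumes "k \<in> carrier K" "g \<in> carrier G" "b \<in> carrier A" "h \<in> carrier G"
  shows "(monomial k g \<otimes>\<^bsub>A\<^esub> b) h = k \<otimes>\<^bsub>K\<^esub> b (inv\<^bsub>G\<^esub> g \<otimes>\<^bsub>G\<^esub> h)"
  using mult_eq[OF monomial_closed[OF assms(1,2)] assms(3), of "{g}" h] assms coeff_closed[OF assms(3)]
  by (auto simp: monomial_def)

lemma monomial_mult_monomial: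
  assumes "k \<in> carrier K" "g \<in> carrier G" "l \<in> carrier K" "h \<in> carrier G"
  shows "monomial k g \<otimes>\<^bsub>A\<^esub> monomial l h = monomial (k \<otimes>\<^bsub>K\<^esub> l) (g \<otimes>\<^bsub>G\<^esub> h)"
proof
  fix z
  show "(monomial k g \<otimes>\<^bsub>A\<^esub> monomial l h) z = monomial (k \<otimes>\<^bsub>K\<^esub> l) (g \<otimes>\<^bsub>G\<^esub> h) z"
  proof (cases "z \<in> carrier G")
    case True
    have "inv\<^bsub>G\<^esub> g \<otimes>\<^bsub>G\<^esub> z = h \<longleftrightarrow> z = g \<otimes>\<^bsub>G\<^esub> h"
      using True assms by (metis G.inv_solve_left)
    then show ?thesis
      using monomial_mult[OF assms(1,2) monomial_closed[OF assms(3,4)] True] assms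
      by (auto simp: monomial_def)
  next
    case False
    then show ?thesis
      using assms by (auto simp: mult_outside monomial_def)
  qed
qed

lemma l_distr:
  assumes "a \<in> carrier A" "b \<in> carrier A" "c \<in> carrier A"
  shows "(a \<oplus>\<^bsub>A\<^esub> b) \<otimes>\<^bsub>A\<^esub> c = a \<otimes>\<^bsub>A\<^esub> c \<oplus>\<^bsub>A\<^esub> b \<otimes>\<^bsub>A\<^esub> c"
proof
  fix g
  show "((a \<oplus>\<^bsub>A\<^esub> b) \<otimes>\<^bsub>A\<^esub> c) g = (a \<otimes>\<^bsub>A\<^esub> c \<oplus>\<^bsub>A\<^esub> b \<otimes>\<^bsub>A\<^esub> c) g"
  proof (cases "g \<in> carrier G")
    case True
    obtain F where F: "finite F" "F \<subseteq> carrier G" "\<And>g. g \<notin> F \<Longrightarrow> a g = \<zero>\<^bsub>K\<^esub>"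
      using supportE[OF assms(1)] by blast
    obtain F' where F': "finite F'" "F' \<subseteq> carrier G" "\<And>g. g \<notin> F' \<Longrightarrow> b g = \<zero>\<^bsub>K\<^esub>"
      using supportE[OF assms(2)] by blast
    let ?F = "F \<union> F'"
    have fin: "finite ?F" "?F \<subseteq> carrier G" using F F' by auto
    note closed = coeff_closed[OF assms(1)] coeff_closed[OF assms(2)] coeff_closed[OF assms(3)]
    have "(a \<otimes>\<^bsub>A\<^esub> c) g = (\<Oplus>\<^bsub>K\<^esub>h\<in>?F. a h \<otimes>\<^bsub>K\<^esub> c (inv\<^bsub>G\<^esub> h \<otimes>\<^bsub>G\<^esub> g))"
      "(b \<otimes>\<^bsub>A\<^esub> c) g = (\<Oplus>\<^bsub>K\<^esub>h\<in>?F. b h \<otimes>\<^bsub>K\<^esub> c (inv\<^bsub>G\<^esub> h \<otimes>\<^bsub>G\<^esub> g))"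
      "((a \<oplus>\<^bsub>A\<^esub> b) \<otimes>\<^bsub>A\<^esub> c) g = (\<Oplus>\<^bsub>K\<^esub>h\<in>?F. (a \<oplus>\<^bsub>A\<^esub> b) h \<otimes>\<^bsub>K\<^esub> c (inv\<^bsub>G\<^esub> h \<otimes>\<^bsub>G\<^esub> g))"
      by (intro mult_eq assms add_closed fin True; simp add: F F' add_eq)+
    then show ?thesis
      using closed by (simp add: add_eq K.l_distr K.finsum_addf)
  qed (simp add: add_eq mult_outside)
qed

lemma r_distr:
  assumes "a \<in> carrier A" "b \<in> carrier A" "c \<in> carrier A"
  shows "c \<otimes>\<^bsub>A\<^esub> (a \<oplus>\<^bsub>A\<^esub> b) = c \<otimes>\<^bsub>A\<^esub> a \<oplus>\<^bsub>A\<^esub> c \<otimes>\<^bsub>A\<^esub> b"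
proof
  fix g
  show "(c \<otimes>\<^bsub>A\<^esub> (a \<oplus>\<^bsub>A\<^esub> b)) g = (c \<otimes>\<^bsub>A\<^esub> a \<oplus>\<^bsub>A\<^esub> c \<otimes>\<^bsub>A\<^esub> b) g"
  proof (cases "g \<in> carrier G")
    case True
    obtain F where F: "finite F" "F \<subseteq> carrier G" "\<And>g. g \<notin> F \<Longrightarrow> c g = \<zero>\<^bsub>K\<^esub>"
      using supportE[OF assms(3)] by blast
    note closed = coeff_closed[OF assms(1)] coeff_closed[OF assms(2)] coeff_closed[OF assms(3)]
    show ?thesis
      using closed mult_eq[OF assms(3) _ F True] assms
      by (simp add: add_closed) (simp add: add_eq mult_eq[OF assms(3) _ F True] K.r_distr K.finsum_addf)
  qed (simp add: add_eq mult_outside)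
qed

text \<open>Splits off one coefficient at a time. Additive identities are thereby reduced to
  monomials, which replaces the reordering of nested sums by the group laws.\<close>

lemma additive_induct [consumes 1, case_names monomial add]:
  assumes "a \<in> carrier A"
    and mono: "\<And>k g. k \<in> carrier K \<Longrightarrow> g \<in> carrier G \<Longrightarrow> P (monomial k g)"
    and add: "\<And>a b. a \<in> carrier A \<Longrightarrow> b \<in> carrier A \<Longrightarrow> P a \<Longrightarrow> P b \<Longrightarrow> P (a \<oplus>\<^bsub>A\<^esub> b)"
  shows "P a"
proof -
  obtain F where "finite F" "F \<subseteq> carrier G" "\<And>g. g \<notin> F \<Longrightarrow> a g = \<zero>\<^bsub>K\<^esub>"
    using supportE[OF assms(1)] by blast
  then show ?thesis using assms(1)
  proof (induction F arbitrary: a rule: finite_induct)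
    case empty
    \<comment> \<open>Zero is a monomial with zero coefficient, so the rule has no separate case for
      it.\<close>
    then have "a = monomial \<zero>\<^bsub>K\<^esub> \<one>\<^bsub>G\<^esub>" by (auto simp: monomial_def)
    then show ?case using mono by simp
  next
    case (insert g F)
    define b where "b = a(g := \<zero>\<^bsub>K\<^esub>)"
    have b: "b \<in> carrier A"
      by (rule carrierI[of _ F]) (use insert coeff_closed[OF insert.prems(3)] in \<open>auto simp: b_def\<close>)
    have "b h = \<zero>\<^bsub>K\<^esub>" if "h \<notin> F" for h using insert.prems(2) that by (simp add: b_def)
    then have "P b" using insert.IH[of b] insert.prems b by simp
    moreover have "a = monomial (a g) g \<oplus>\<^bsub>A\<^esub> b"
      using coeff_closed[OF insert.prems(3)] by (auto simp: b_def add_eq monomial_def)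
    moreover have "a g \<in> carrier K" "g \<in> carrier G"
      using insert coeff_closed by auto
    ultimately show ?case
      using add[OF monomial_closed b mono] by metis
  qed
qed

text \<open>Both sides are additive in each argument; three nested inductions leave associativity in
  \<open>K\<close> and in \<open>G\<close>.\<close>

lemma m_assoc:
  assumes "a \<in> carrier A" "b \<in> carrier A" "c \<in> carrier A"
  shows "a \<otimes>\<^bsub>A\<^esub> b \<otimes>\<^bsub>A\<^esub> c = a \<otimes>\<^bsub>A\<^esub> (b \<otimes>\<^bsub>A\<^esub> c)"
  using assms(1)
proof (induction rule: additive_induct)
  case a: (monomial k g)
  from assms(2) show ?case
  proof (induction rule: additive_induct)
    case b: (monomial l h)
    from assms(3) show ?case
      by (induction rule: additive_induct)
        (use a b in \<open>simp_all add: monomial_mult_monomial monomial_closed mult_closed r_distr K.m_assoc G.m_assoc\<close>)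
  qed (use a assms in \<open>simp add: monomial_closed mult_closed l_distr r_distr\<close>)
qed (use assms in \<open>simp add: mult_closed l_distr\<close>)

lemma ring_group_ring: "ring A"
proof (rule ringI)
  show "monoid A"
  proof (rule monoidI)
    show "\<one>\<^bsub>A\<^esub> \<in> carrier A" by (simp add: one_eq monomial_closed)
    show "\<one>\<^bsub>A\<^esub> \<otimes>\<^bsub>A\<^esub> a = a" "a \<otimes>\<^bsub>A\<^esub> \<one>\<^bsub>A\<^esub> = a" if "a \<in> carrier A" for a
      using that by (induction rule: additive_induct)
        (simp_all add: one_eq monomial_mult_monomial monomial_closed l_distr r_distr)
  qed (auto simp: mult_closed m_assoc)
qed (auto simp: abelian_group_group_ring l_distr r_distr)

text \<open>By distributivity, an additive map that is multiplicative on monomials is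
  multiplicative. Serves both the augmentation and the linear extension.\<close>

lemma ring_homI:
  assumes "ring S" and closed: "\<And>a. a \<in> carrier A \<Longrightarrow> f a \<in> carrier S"
    and add: "\<And>a b. a \<in> carrier A \<Longrightarrow> b \<in> carrier A \<Longrightarrow> f (a \<oplus>\<^bsub>A\<^esub> b) = f a \<oplus>\<^bsub>S\<^esub> f b"
    and mult: "\<And>k g l h. k \<in> carrier K \<Longrightarrow> g \<in> carrier G \<Longrightarrow> l \<in> carrier K \<Longrightarrow> h \<in> carrier G \<Longrightarrow>
      f (monomial (k \<otimes>\<^bsub>K\<^esub> l) (g \<otimes>\<^bsub>G\<^esub> h)) = f (monomial k g) \<otimes>\<^bsub>S\<^esub> f (monomial l h)"
    and one: "f (monomial \<one>\<^bsub>K\<^esub> \<one>\<^bsub>G\<^esub>) = \<one>\<^bsub>S\<^esub>"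
  shows "f \<in> ring_hom A S"
proof (rule ring_hom_memI)
  interpret S: ring S by fact
  show "f (a \<otimes>\<^bsub>A\<^esub> b) = f a \<otimes>\<^bsub>S\<^esub> f b" if "a \<in> carrier A" "b \<in> carrier A" for a b
    using that(1)
  proof (induction rule: additive_induct)
    case a: (monomial k g)
    from that(2) show ?case
      by (induction rule: additive_induct)
        (use a in \<open>simp_all add: monomial_mult_monomial mult monomial_closed mult_closed r_distr add closed S.r_distr\<close>)
  qed (use that in \<open>simp add: mult_closed l_distr add closed S.l_distr\<close>)
qed (simp_all add: closed add one one_eq)

lemma augmentation_eq:
  assumes "a \<in> carrier A" "finite F" "F \<subseteq> carrier G" "\<And>g. g \<notin> F \<Longrightarrow> a g = \<zero>\<^bsub>K\<^esub>"
  shows "augmentation K G a = (\<Oplus>\<^bsub>K\<^esub>g\<in>F. a g)"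
  using finsum_support[OF assms, of a "\<lambda>_. True"] coeff_closed[OF assms(1)] by (simp add: augmentation_def)

lemma augmentation_hom: "augmentation K G \<in> ring_hom A K"
proof (rule ring_homI)
  show "ring K" by (rule K.ring_axioms)
  show "augmentation K G a \<in> carrier K" if "a \<in> carrier A" for a
    unfolding augmentation_def using coeff_closed[OF that] by (intro K.finsum_closed) auto
  show "augmentation K G (a \<oplus>\<^bsub>A\<^esub> b) = augmentation K G a \<oplus>\<^bsub>K\<^esub> augmentation K G b"
    if ab: "a \<in> carrier A" "b \<in> carrier A" for a b
  proof -
    obtain F where F: "finite F" "F \<subseteq> carrier G" "\<And>g. g \<notin> F \<Longrightarrow> a g = \<zero>\<^bsub>K\<^esub>"
      using supportE[OF ab(1)] by blast
    obtain F' where F': "finite F'" "F' \<subseteq> carrier G" "\<And>g. g \<notin> F' \<Longrightarrow> b g = \<zero>\<^bsub>K\<^esub>"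
      using supportE[OF ab(2)] by blast
    have "augmentation K G a = (\<Oplus>\<^bsub>K\<^esub>g\<in>F \<union> F'. a g)" "augmentation K G b = (\<Oplus>\<^bsub>K\<^esub>g\<in>F \<union> F'. b g)"
      "augmentation K G (a \<oplus>\<^bsub>A\<^esub> b) = (\<Oplus>\<^bsub>K\<^esub>g\<in>F \<union> F'. (a \<oplus>\<^bsub>A\<^esub> b) g)"
      by (intro augmentation_eq add_closed ab; use F F' in \<open>simp add: add_eq\<close>)+
    then show ?thesis
      using coeff_closed[OF ab(1)] coeff_closed[OF ab(2)] by (simp add: add_eq K.finsum_addf)
  qed
  have aug: "augmentation K G (monomial k g) = k" if "k \<in> carrier K" "g \<in> carrier G" for k g
    using augmentation_eq[OF monomial_closed[OF that], of "{g}"] that by (auto simp: monomial_def)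
  show "augmentation K G (monomial \<one>\<^bsub>K\<^esub> \<one>\<^bsub>G\<^esub>) = \<one>\<^bsub>K\<^esub>" by (simp add: aug)
  show "augmentation K G (monomial (k \<otimes>\<^bsub>K\<^esub> l) (g \<otimes>\<^bsub>G\<^esub> h)) =
      augmentation K G (monomial k g) \<otimes>\<^bsub>K\<^esub> augmentation K G (monomial l h)"
    if "k \<in> carrier K" "g \<in> carrier G" "l \<in> carrier K" "h \<in> carrier G" for k g l h
    using that by (simp add: aug)
qed

lemma augmentation_ideal_ideal: "ideal (augmentation_ideal K G) A"
proof -
  interpret ring_hom_ring A K "augmentation K G"
    using ring_group_ring K.ring_axioms augmentation_hom by (simp add: ring_hom_ring_def ring_hom_ring_axioms_def)
  show ?thesis unfolding augmentation_ideal_def by (rule kernel_is_ideal)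
qed

end

section \<open>Linear extensions of group homomorphisms\<close>

locale group_algebra_hom = group_algebra K G + H: group_algebra K H
  for K :: "('k, 'm) ring_scheme" and G :: "('g, 'n) monoid_scheme" and H :: "('h, 'p) monoid_scheme" +
  fixes \<nu> :: "'g \<Rightarrow> 'h"
  assumes hom: "\<nu> \<in> hom G H"
begin

lemma linear_extension_eq:
  assumes "a \<in> carrier A" "finite F" "F \<subseteq> carrier G" "\<And>g. g \<notin> F \<Longrightarrow> a g = \<zero>\<^bsub>K\<^esub>"
  shows "linear_extension K G \<nu> a h = (\<Oplus>\<^bsub>K\<^esub>g\<in>{g \<in> F. \<nu> g = h}. a g)"
  unfolding linear_extension_def
  using finsum_support[OF assms, of a "\<lambda>g. \<nu> g = h"] coeff_closed[OF assms(1)] by simp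

lemma linear_extension_monomial:
  assumes "k \<in> carrier K" "g \<in> carrier G"
  shows "linear_extension K G \<nu> (monomial k g) = H.monomial k (\<nu> g)"
proof
  fix h
  have "{g' \<in> {g}. \<nu> g' = h} = (if h = \<nu> g then {g} else {})" by auto
  then show "linear_extension K G \<nu> (monomial k g) h = H.monomial k (\<nu> g) h"
    using linear_extension_eq[OF monomial_closed[OF assms], of "{g}" h] assms
    by (auto simp: monomial_def H.monomial_def)
qed

lemma linear_extension_closed:
  assumes a: "a \<in> carrier A"
  shows "linear_extension K G \<nu> a \<in> carrier (group_ring K H)"
proof -
  obtain F where F: "finite F" "F \<subseteq> carrier G" "\<And>g. g \<notin> F \<Longrightarrow> a g = \<zero>\<^bsub>K\<^esub>"
    using supportE[OF a] by blast
  show ?thesis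
  proof (rule H.carrierI[of _ "\<nu> ` F"])
    show "linear_extension K G \<nu> a h \<in> carrier K" for h
      unfolding linear_extension_def using coeff_closed[OF a] by (intro K.finsum_closed) auto
    show "linear_extension K G \<nu> a h = \<zero>\<^bsub>K\<^esub>" if "h \<notin> \<nu> ` F" for h
    proof -
      have "{g \<in> F. \<nu> g = h} = {}" using that by auto
      moreover have "linear_extension K G \<nu> a h = (\<Oplus>\<^bsub>K\<^esub>g\<in>{g \<in> F. \<nu> g = h}. a g)"
        by (rule linear_extension_eq[OF a F])
      ultimately show ?thesis by (simp only: K.finsum_empty)
    qed
  qed (use F hom_in_carrier[OF hom] in auto)
qed

lemma linear_extension_add:
  assumes ab: "a \<in> carrier A" "b \<in> carrier A"
  shows "linear_extension K G \<nu> (a \<oplus>\<^bsub>A\<^esub> b) =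
    linear_extension K G \<nu> a \<oplus>\<^bsub>group_ring K H\<^esub> linear_extension K G \<nu> b"
proof
  fix h
  obtain F where F: "finite F" "F \<subseteq> carrier G" "\<And>g. g \<notin> F \<Longrightarrow> a g = \<zero>\<^bsub>K\<^esub>"
    using supportE[OF ab(1)] by blast
  obtain F' where F': "finite F'" "F' \<subseteq> carrier G" "\<And>g. g \<notin> F' \<Longrightarrow> b g = \<zero>\<^bsub>K\<^esub>"
    using supportE[OF ab(2)] by blast
  let ?F = "{g \<in> F \<union> F'. \<nu> g = h}"
  have "linear_extension K G \<nu> a h = (\<Oplus>\<^bsub>K\<^esub>g\<in>?F. a g)" "linear_extension K G \<nu> b h = (\<Oplus>\<^bsub>K\<^esub>g\<in>?F. b g)"
    "linear_extension K G \<nu> (a \<oplus>\<^bsub>A\<^esub> b) h = (\<Oplus>\<^bsub>K\<^esub>g\<in>?F. (a \<oplus>\<^bsub>A\<^esub> b) g)"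
    by (intro linear_extension_eq add_closed ab; use F F' in \<open>simp add: add_eq\<close>)+
  then show "linear_extension K G \<nu> (a \<oplus>\<^bsub>A\<^esub> b) h =
      (linear_extension K G \<nu> a \<oplus>\<^bsub>group_ring K H\<^esub> linear_extension K G \<nu> b) h"
    using coeff_closed[OF ab(1)] coeff_closed[OF ab(2)] by (simp add: add_eq H.add_eq K.finsum_addf)
qed

lemma linear_extension_hom: "linear_extension K G \<nu> \<in> ring_hom A (group_ring K H)"
  using hom_one[OF hom G.group_axioms H.G.group_axioms] hom_mult[OF hom] hom_in_carrier[OF hom]
  by (intro ring_homI H.ring_group_ring)
    (simp_all add: linear_extension_closed linear_extension_add linear_extension_monomial
      H.monomial_mult_monomial H.one_eq)

text \<open>Monomials lift along \<nu>, and the image is closed under sums.\<close>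

lemma linear_extension_surj:
  assumes "\<nu> ` carrier G = carrier H"
  shows "linear_extension K G \<nu> ` carrier A = carrier (group_ring K H)"
proof
  show "carrier (group_ring K H) \<subseteq> linear_extension K G \<nu> ` carrier A"
  proof
    fix b assume "b \<in> carrier (group_ring K H)"
    then show "b \<in> linear_extension K G \<nu> ` carrier A"
    proof (induction rule: H.additive_induct)
      case (monomial k h)
      then obtain g where "g \<in> carrier G" "h = \<nu> g" using assms by blast
      with monomial show ?case
        using linear_extension_monomial monomial_closed by (metis imageI)
    next
      case (add b c)
      then obtain b' c' where "b' \<in> carrier A" "c' \<in> carrier A"
        "b = linear_extension K G \<nu> b'" "c = linear_extension K G \<nu> c'" by blast
      then show ?case
        by (intro image_eqI[of _ _ "b' \<oplus>\<^bsub>A\<^esub> c'"]) (simp_all add: linear_extension_add add_closed)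
    qed
  qed
qed (use linear_extension_closed in blast)

end

section \<open>Powers of ideals and their extension along a ring homomorphism\<close>

lemma ideal_power_0 [simp]: "ideal_power R I 0 = carrier R"
  by (simp add: ideal_power_def ideals_set_def nat_pow_def)

lemma ideal_power_Suc [simp]: "ideal_power R I (Suc n) = ideal_prod R (ideal_power R I n) I"
  by (simp add: ideal_power_def ideals_set_def nat_pow_def)

lemma (in ring) ideal_power_ideal: "ideal I R \<Longrightarrow> ideal (ideal_power R I n) R"
  by (induction n) (auto simp: oneideal ideal_prod_is_ideal)

text \<open>The hypothesis \<open>swap\<close> replaces commutativity of \<open>R\<close>; it also holds when \<open>\<rho>\<close> is surjective.\<close>

locale extension_of_ideals = P: ring P + R: ring R
  for P :: "('s, 'm) ring_scheme" and R :: "('r, 'n) ring_scheme" +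
  fixes \<rho> :: "'s \<Rightarrow> 'r"
  assumes hom: "\<rho> \<in> ring_hom P R"
    and swap: "\<And>L a s. ideal L P \<Longrightarrow> a \<in> L \<Longrightarrow> s \<in> carrier R \<Longrightarrow>
      \<exists>a'\<in>L. \<exists>t\<in>carrier R. \<rho> a \<otimes>\<^bsub>R\<^esub> s = t \<otimes>\<^bsub>R\<^esub> \<rho> a'"
begin

text \<open>\<open>span_ideal_power\<close> with an arbitrary \<open>L\<close> in place of a power
  of \<open>I\<close>, so that products of ideals can be treated before powers.\<close>

definition extension :: "'s set \<Rightarrow> 'r set" where
  "extension L = generate (add_monoid R) {r \<otimes>\<^bsub>R\<^esub> \<rho> a | r a. r \<in> carrier R \<and> a \<in> L}"

context
  fixes L assumes L: "ideal L P"
begin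

lemma rho_closed: "a \<in> L \<Longrightarrow> \<rho> a \<in> carrier R"
  using ideal.Icarr[OF L] ring_hom_closed[OF hom] by blast

lemma generators_subset: "{r \<otimes>\<^bsub>R\<^esub> \<rho> a | r a. r \<in> carrier R \<and> a \<in> L} \<subseteq> carrier R"
  using rho_closed by auto

lemma subgroup_extension: "subgroup (extension L) (add_monoid R)"
  unfolding extension_def by (rule R.add.generate_is_subgroup[OF generators_subset])

lemma extension_closed: "y \<in> extension L \<Longrightarrow> y \<in> carrier R"
  using subgroup.subset[OF subgroup_extension] by auto

lemma extension_add: "y \<in> extension L \<Longrightarrow> z \<in> extension L \<Longrightarrow> y \<oplus>\<^bsub>R\<^esub> z \<in> extension L"
  using subgroup.m_closed[OF subgroup_extension] by simp

lemma extension_generator: "r \<in> carrier R \<Longrightarrow> a \<in> L \<Longrightarrow> r \<otimes>\<^bsub>R\<^esub> \<rho> a \<in> extension L"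
  unfolding extension_def by (rule generate.incl) blast

text \<open>The generators include zero, with both factors zero, and are closed under negation of
  \<open>r\<close>; this disposes of the neutral and inverse cases of
  \<open>generate\<close>.\<close>

lemma extension_induct [consumes 1, case_names generator add]:
  assumes "y \<in> extension L"
    and gen: "\<And>r a. r \<in> carrier R \<Longrightarrow> a \<in> L \<Longrightarrow> Q (r \<otimes>\<^bsub>R\<^esub> \<rho> a)"
    and add: "\<And>y z. y \<in> extension L \<Longrightarrow> z \<in> extension L \<Longrightarrow> Q y \<Longrightarrow> Q z \<Longrightarrow> Q (y \<oplus>\<^bsub>R\<^esub> z)"
  shows "Q y"
  using assms(1) unfolding extension_def
proof (induction rule: generate.induct)
  case one
  have "\<zero>\<^bsub>P\<^esub> \<in> L" using L by (simp add: additive_subgroup.zero_closed ideal.axioms(1))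
  then show ?case using gen[of "\<zero>\<^bsub>R\<^esub>" "\<zero>\<^bsub>P\<^esub>"] rho_closed by simp
next
  case (inv h)
  then obtain r a where h: "h = r \<otimes>\<^bsub>R\<^esub> \<rho> a" "r \<in> carrier R" "a \<in> L" by blast
  then have "inv\<^bsub>add_monoid R\<^esub> h = (\<ominus>\<^bsub>R\<^esub> r) \<otimes>\<^bsub>R\<^esub> \<rho> a"
    using rho_closed R.l_minus by (simp add: a_inv_def)
  then show ?case using gen h by simp
next
  case (eng y z)
  then show ?case using add unfolding extension_def by simp
qed (use gen in blast)

text \<open>Absorption on the left is built into the generators. On the right, \<open>swap\<close>
  turns \<open>r \<rho>(a) s\<close> into \<open>(r t) \<rho>(a')\<close> with \<open>a'\<close>
  still in \<open>L\<close>.\<close>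

lemma ideal_extension: "ideal (extension L) R"
proof (rule idealI)
  show "ring R" by (rule R.ring_axioms)
  show "subgroup (extension L) (add_monoid R)" by (rule subgroup_extension)
  fix y s assume y: "y \<in> extension L" and s: "s \<in> carrier R"
  from y show "s \<otimes>\<^bsub>R\<^esub> y \<in> extension L"
  proof (induction rule: extension_induct)
    case (generator r a)
    then show ?case
      using s rho_closed extension_generator[of "s \<otimes>\<^bsub>R\<^esub> r" a] by (simp add: R.m_assoc)
  qed (use s in \<open>simp add: R.r_distr extension_closed extension_add\<close>)
  from y show "y \<otimes>\<^bsub>R\<^esub> s \<in> extension L"
  proof (induction rule: extension_induct)
    case (generator r a)
    then obtain a' t where "a' \<in> L" "t \<in> carrier R" "\<rho> a \<otimes>\<^bsub>R\<^esub> s = t \<otimes>\<^bsub>R\<^esub> \<rho> a'"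
      using swap[OF L _ s] by blast
    moreover from this have "(r \<otimes>\<^bsub>R\<^esub> \<rho> a) \<otimes>\<^bsub>R\<^esub> s = (r \<otimes>\<^bsub>R\<^esub> t) \<otimes>\<^bsub>R\<^esub> \<rho> a'"
      using s rho_closed generator by (simp add: R.m_assoc)
    ultimately show ?case
      using generator extension_generator[of "r \<otimes>\<^bsub>R\<^esub> t" a'] by simp
  qed (use s in \<open>simp add: R.l_distr extension_closed extension_add\<close>)
qed

end

text \<open>In \<open>r \<rho>(a) s \<rho>(b)\<close>, \<open>swap\<close> carries the scalar
  \<open>s\<close> to the left, giving \<open>(r t) \<rho>(a' b)\<close>. Since \<open>a'\<close>
  stays in \<open>L\<close>, the product \<open>a' b\<close> lies in the product ideal.\<close>

lemma extension_mult:
  assumes L: "ideal L P" "ideal L' P" and y: "y \<in> extension L" and z: "z \<in> extension L'"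
  shows "y \<otimes>\<^bsub>R\<^esub> z \<in> extension (ideal_prod P L L')"
proof -
  note LL = P.ideal_prod_is_ideal[OF L]
  show ?thesis
    using y
  proof (induction rule: extension_induct[OF L(1), consumes 1, case_names generator add])
    case (generator r a)
    from z show ?case
    proof (induction rule: extension_induct[OF L(2), consumes 1, case_names generator add])
      case (generator s b)
      obtain a' t where a': "a' \<in> L" "t \<in> carrier R" "\<rho> a \<otimes>\<^bsub>R\<^esub> s = t \<otimes>\<^bsub>R\<^esub> \<rho> a'"
        using swap[OF L(1)] \<open>a \<in> L\<close> \<open>s \<in> carrier R\<close> by blast
      note c = rho_closed[OF L(1) a'(1)] rho_closed[OF L(1) \<open>a \<in> L\<close>] rho_closed[OF L(2) \<open>b \<in> L'\<close>]
      have "(r \<otimes>\<^bsub>R\<^esub> \<rho> a) \<otimes>\<^bsub>R\<^esub> (s \<otimes>\<^bsub>R\<^esub> \<rho> b) = r \<otimes>\<^bsub>R\<^esub> (\<rho> a \<otimes>\<^bsub>R\<^esub> s) \<otimes>\<^bsub>R\<^esub> \<rho> b"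
        using c \<open>r \<in> carrier R\<close> \<open>s \<in> carrier R\<close> by (simp add: R.m_assoc)
      also have "\<dots> = (r \<otimes>\<^bsub>R\<^esub> t) \<otimes>\<^bsub>R\<^esub> (\<rho> a' \<otimes>\<^bsub>R\<^esub> \<rho> b)"
        unfolding a'(3) using c a' \<open>r \<in> carrier R\<close> by (simp add: R.m_assoc)
      also have "\<rho> a' \<otimes>\<^bsub>R\<^esub> \<rho> b = \<rho> (a' \<otimes>\<^bsub>P\<^esub> b)"
        using ring_hom_mult[OF hom] ideal.Icarr[OF L(1) a'(1)] ideal.Icarr[OF L(2) \<open>b \<in> L'\<close>] by simp
      finally show ?case
        using extension_generator[OF LL, of "r \<otimes>\<^bsub>R\<^esub> t" "a' \<otimes>\<^bsub>P\<^esub> b"] a' \<open>r \<in> carrier R\<close> \<open>b \<in> L'\<close>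
        by (simp add: ideal_prod.prod)
    qed (use generator rho_closed[OF L(1)] in
        \<open>simp add: R.r_distr extension_closed[OF L(2)] extension_add[OF LL]\<close>)
  qed (use z in \<open>simp add: R.l_distr extension_closed[OF L(1)] extension_closed[OF L(2)] extension_add[OF LL]\<close>)
qed

lemma ideal_power_subset_extension:
  assumes L: "ideal L P"
  shows "ideal_power R (Idl\<^bsub>R\<^esub> (\<rho> ` L)) k \<subseteq> extension (ideal_power P L k)"
proof (induction k)
  case 0
  \<comment> \<open>The zeroth powers are the whole rings, and
    \<open>r = r \<rho>(1)\<close>.\<close>
  have "r \<in> extension (carrier P)" if "r \<in> carrier R" for r
    using extension_generator[OF P.oneideal that P.one_closed] that ring_hom_one[OF hom] by simp
  then show ?case by auto
next
  case (Suc k)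
  have Lk: "ideal (ideal_power P L k) P" by (rule P.ideal_power_ideal[OF L])
  \<comment> \<open>The left-hand side is the smallest two-sided ideal containing
    \<open>\<rho>(L)\<close>; minimality applies because \<open>extension L\<close> is
    two-sided.\<close>
  have J: "Idl\<^bsub>R\<^esub> (\<rho> ` L) \<subseteq> extension L"
  proof (rule R.genideal_minimal[OF ideal_extension[OF L]], rule image_subsetI)
    show "\<rho> a \<in> extension L" if "a \<in> L" for a
      using extension_generator[OF L R.one_closed that] rho_closed[OF L that] by simp
  qed
  show ?case
  proof
    fix y assume "y \<in> ideal_power R (Idl\<^bsub>R\<^esub> (\<rho> ` L)) (Suc k)"
    then have "y \<in> ideal_prod R (ideal_power R (Idl\<^bsub>R\<^esub> (\<rho> ` L)) k) (Idl\<^bsub>R\<^esub> (\<rho> ` L))" by simp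
    then show "y \<in> extension (ideal_power P L (Suc k))"
    proof (induction rule: ideal_prod.induct)
      case (prod i j)
      then show ?case using extension_mult[OF Lk L] Suc.IH J by auto
    next
      case (sum y z)
      then show ?case using extension_add[OF P.ideal_power_ideal[OF L]] by blast
    qed
  qed
qed

text \<open>Supplies the map of coefficients \<open>s \<mapsto> r s\<close> from \<open>R\<close>
  into the extended power, by absorption on the right.\<close>

lemma ideal_power_times_subset:
  assumes L: "ideal L P" and "r \<in> ideal_power R (Idl\<^bsub>R\<^esub> (\<rho> ` L)) k" "s \<in> carrier R"
  shows "r \<otimes>\<^bsub>R\<^esub> s \<in> extension (ideal_power P L k)"
  using ideal.I_r_closed[OF ideal_extension[OF P.ideal_power_ideal[OF L]]]
    ideal_power_subset_extension[OF L] assms(2,3) by blast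

end


section \<open>Complexes, homology and tensor products\<close>

lemma comm_group_subgroup:
  assumes "comm_group G" "subgroup H G"
  shows "comm_group (G\<lparr>carrier := H\<rparr>)"
proof -
  interpret comm_group G by fact
  show ?thesis
    using subgroup.subgroup_is_group[OF assms(2) group_axioms] subgroup.mem_carrier[OF assms(2)]
    by (intro group.group_comm_groupI) (auto simp: m_comm)
qed

context
  fixes G :: "('a, 'm) monoid_scheme" and H :: "('b, 'n) monoid_scheme" and f
  assumes G: "comm_group G" and H: "comm_group H" and f: "f \<in> hom G H"
begin

lemma hom_image_subgroup:
  assumes "subgroup A G"
  shows "subgroup (f ` A) H"
proof -
  interpret group_hom G H f
    using G H f by (simp add: group_hom_def group_hom_axioms_def comm_group.axioms)
  show ?thesis by (rule subgroup_img_is_subgroup[OF assms])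
qed

text \<open>As \<open>f\<close> carries \<open>A\<close> into \<open>B\<close>, all cosets in the
  union defining \<open>coset_map\<close> coincide. The induced maps on tensor products and on
  homology are both evaluated this way.\<close>

lemma coset_map_coset:
  assumes A: "subgroup A G" and B: "subgroup B H" and "f ` A \<subseteq> B" and x: "x \<in> carrier G"
  shows "coset_map H B f (A #>\<^bsub>G\<^esub> x) = B #>\<^bsub>H\<^esub> f x"
proof -
  interpret G: comm_group G by (rule G)
  interpret H: comm_group H by (rule H)
  have "B #>\<^bsub>H\<^esub> f (a \<otimes>\<^bsub>G\<^esub> x) = B #>\<^bsub>H\<^esub> f x" if a: "a \<in> A" for a
  proof -
    have *: "a \<in> carrier G" "f a \<in> B" "f a \<in> carrier H" "f x \<in> carrier H" "B \<subseteq> carrier H"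
      using a assms subgroup.subset[OF A] subgroup.subset[OF B] hom_in_carrier[OF f] by auto
    then have "B #>\<^bsub>H\<^esub> f (a \<otimes>\<^bsub>G\<^esub> x) = (B #>\<^bsub>H\<^esub> f a) #>\<^bsub>H\<^esub> f x"
      using x by (simp add: hom_mult[OF f] H.coset_mult_assoc)
    also have "B #>\<^bsub>H\<^esub> f a = B"
      using * by (intro H.coset_join2 B)
    finally show ?thesis .
  qed
  then show ?thesis
    using subgroup.one_closed[OF A] unfolding coset_map_def r_coset_def[of G A] by auto
qed

lemma coset_map_hom:
  assumes A: "subgroup A G" and B: "subgroup B H" and "f ` A \<subseteq> B"
  shows "coset_map H B f \<in> hom (G Mod A) (H Mod B)"
proof -
  interpret G: comm_group G by (rule G)
  interpret H: comm_group H by (rule H)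
  interpret A: normal A G by (rule G.subgroup_imp_normal[OF A])
  interpret B: normal B H by (rule H.subgroup_imp_normal[OF B])
  show ?thesis
    using coset_map_coset[OF assms] hom_in_carrier[OF f] hom_mult[OF f]
    by (auto simp: hom_def FactGroup_def RCOSETS_def A.rcos_sum B.rcos_sum)
qed

end

section \<open>Chain complexes, chain maps and homology\<close>

definition chain_complex :: "(int \<Rightarrow> 'a monoid) \<Rightarrow> (int \<Rightarrow> 'a \<Rightarrow> 'a) \<Rightarrow> bool" where
  "chain_complex T d \<longleftrightarrow> (\<forall>n. comm_group (T n) \<and> d n \<in> hom (T n) (T (n - 1)))"

definition chain_map ::
  "(int \<Rightarrow> 'a monoid) \<Rightarrow> (int \<Rightarrow> 'a \<Rightarrow> 'a) \<Rightarrow> (int \<Rightarrow> 'b monoid) \<Rightarrow> (int \<Rightarrow> 'b \<Rightarrow> 'b) \<Rightarrow>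
   (int \<Rightarrow> 'a \<Rightarrow> 'b) \<Rightarrow> bool" where
  "chain_map T d T' d' f \<longleftrightarrow>
     (\<forall>n. f n \<in> hom (T n) (T' n) \<and> (\<forall>t\<in>carrier (T n). d' n (f n t) = f (n - 1) (d n t)))"

context
  fixes T :: "int \<Rightarrow> 'a monoid" and d
  assumes T: "chain_complex T d"
begin

lemma chain_group: "comm_group (T n)" and chain_boundary_hom: "d n \<in> hom (T n) (T (n - 1))"
  using T by (auto simp: chain_complex_def)

lemma subgroup_boundaries: "subgroup (complex_boundaries T d n) (T n)"
proof -
  have "d (n + 1) \<in> hom (T (n + 1)) (T n)"
    using chain_boundary_hom[of "n + 1"] by simp
  then show ?thesis
    unfolding complex_boundaries_def
    using hom_image_subgroup[OF chain_group chain_group _ group.subgroup_self] chain_group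
    by (metis comm_group.axioms(2))
qed

lemma subgroup_cycles: "subgroup (kernel (T n) (T (n - 1)) (d n)) (T n)"
proof -
  interpret group_hom "T n" "T (n - 1)" "d n"
    using chain_group chain_boundary_hom by (simp add: group_hom_def group_hom_axioms_def comm_group.axioms)
  show ?thesis by (rule subgroup_kernel)
qed

text \<open>Since \<open>d \<circ> d = 0\<close> is not required, the homology is described as a subgroup of the
  quotient of all chains by the boundaries, rather than as a quotient of the cycles.\<close>

lemma complex_homology_eq:
  "complex_homology T d n =
     (T n Mod complex_boundaries T d n)
       \<lparr>carrier := (\<lambda>z. complex_boundaries T d n #>\<^bsub>T n\<^esub> z) ` kernel (T n) (T (n - 1)) (d n)\<rparr>"
  by (auto simp: complex_homology_def FactGroup_def RCOSETS_def set_mult_def r_coset_def fun_eq_iff)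

lemma carrier_complex_homology:
  "carrier (complex_homology T d n) =
     (\<lambda>z. complex_boundaries T d n #>\<^bsub>T n\<^esub> z) ` kernel (T n) (T (n - 1)) (d n)"
  by (simp add: complex_homology_eq)

lemma comm_group_complex_homology: "comm_group (complex_homology T d n)"
proof -
  interpret comm_group "T n" by (rule chain_group)
  interpret B: normal "complex_boundaries T d n" "T n"
    by (rule subgroup_imp_normal[OF subgroup_boundaries])
  have Q: "comm_group (T n Mod complex_boundaries T d n)"
    by (rule abelian_FactGroup[OF subgroup_boundaries])
  show ?thesis
    unfolding complex_homology_eq
    by (intro comm_group_subgroup Q hom_image_subgroup[OF chain_group Q B.r_coset_hom_Mod] subgroup_cycles)
qed

end

context
  fixes T :: "int \<Rightarrow> 'a monoid" and d and T' :: "int \<Rightarrow> 'b monoid" and d' f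
  assumes T: "chain_complex T d" and T': "chain_complex T' d'" and f: "chain_map T d T' d' f"
begin

lemma chain_map_hom: "f n \<in> hom (T n) (T' n)"
  and chain_map_boundary: "t \<in> carrier (T n) \<Longrightarrow> d' n (f n t) = f (n - 1) (d n t)"
  using f by (auto simp: chain_map_def)

lemma chain_map_boundaries: "f n ` complex_boundaries T d n \<subseteq> complex_boundaries T' d' n"
proof -
  have "f n (d (n + 1) t) \<in> complex_boundaries T' d' n" if t: "t \<in> carrier (T (n + 1))" for t
    using chain_map_boundary[OF t] hom_in_carrier[OF chain_map_hom t]
    by (auto simp: complex_boundaries_def intro!: image_eqI[of _ _ "f (n + 1) t"])
  then show ?thesis by (auto simp: complex_boundaries_def)
qed

lemma chain_map_cycles:
  assumes "z \<in> kernel (T n) (T (n - 1)) (d n)"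
  shows "f n z \<in> kernel (T' n) (T' (n - 1)) (d' n)"
proof -
  have z: "z \<in> carrier (T n)" "d n z = \<one>\<^bsub>T (n - 1)\<^esub>" using assms by (auto simp: kernel_def)
  then have "d' n (f n z) = \<one>\<^bsub>T' (n - 1)\<^esub>"
    using chain_map_boundary hom_one[OF chain_map_hom[of "n - 1"]] chain_group[OF T] chain_group[OF T']
    by (simp add: comm_group.axioms)
  then show ?thesis
    using hom_in_carrier[OF chain_map_hom z(1)] by (simp add: kernel_def)
qed

lemma coset_map_boundaries:
  assumes "z \<in> carrier (T n)"
  shows "coset_map (T' n) (complex_boundaries T' d' n) (f n) (complex_boundaries T d n #>\<^bsub>T n\<^esub> z) =
    complex_boundaries T' d' n #>\<^bsub>T' n\<^esub> f n z"
  by (rule coset_map_coset[OF chain_group[OF T] chain_group[OF T'] chain_map_hom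
        subgroup_boundaries[OF T] subgroup_boundaries[OF T'] chain_map_boundaries assms])

text \<open>Multiplicativity is inherited from the map between chains modulo boundaries; membership
  in the target follows since cycles go to cycles.\<close>

lemma homology_map_hom:
  "coset_map (T' n) (complex_boundaries T' d' n) (f n) \<in> hom (complex_homology T d n) (complex_homology T' d' n)"
proof -
  let ?\<phi> = "coset_map (T' n) (complex_boundaries T' d' n) (f n)"
  have hom: "?\<phi> \<in> hom (T n Mod complex_boundaries T d n) (T' n Mod complex_boundaries T' d' n)"
    by (rule coset_map_hom[OF chain_group[OF T] chain_group[OF T'] chain_map_hom
          subgroup_boundaries[OF T] subgroup_boundaries[OF T'] chain_map_boundaries])
  have Z: "z \<in> carrier (T n)" if "z \<in> kernel (T n) (T (n - 1)) (d n)" for z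
    using that by (auto simp: kernel_def)
  show ?thesis
  proof (rule homI)
    fix h assume "h \<in> carrier (complex_homology T d n)"
    then obtain z where z: "z \<in> kernel (T n) (T (n - 1)) (d n)" "h = complex_boundaries T d n #>\<^bsub>T n\<^esub> z"
      unfolding carrier_complex_homology[OF T] by blast
    show "?\<phi> h \<in> carrier (complex_homology T' d' n)"
      unfolding carrier_complex_homology[OF T'] z(2) coset_map_boundaries[OF Z[OF z(1)]]
      by (rule imageI[OF chain_map_cycles[OF z(1)]])
  next
    have sub: "carrier (complex_homology T d n) \<subseteq> carrier (T n Mod complex_boundaries T d n)"
      unfolding carrier_complex_homology[OF T] using Z by (auto simp: FactGroup_def RCOSETS_def)
    fix h k assume "h \<in> carrier (complex_homology T d n)" "k \<in> carrier (complex_homology T d n)"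
    with sub show "?\<phi> (h \<otimes>\<^bsub>complex_homology T d n\<^esub> k) = ?\<phi> h \<otimes>\<^bsub>complex_homology T' d' n\<^esub> ?\<phi> k"
      using hom_mult[OF hom, of h k] by (auto simp: complex_homology_eq[OF T] complex_homology_eq[OF T'])
  qed
qed

end

section \<open>Tensor products and their functoriality\<close>

text \<open>Associativity of an action reads differently for left and right modules. Closure is
  neutral between the sides, and it places the balancing relations in the free group.\<close>

definition acted :: "'s set \<Rightarrow> ('s, 'm) acted_group \<Rightarrow> bool" where
  "acted S M \<longleftrightarrow> comm_group M \<and> (\<forall>s\<in>S. \<forall>x\<in>carrier M. act M s x \<in> carrier M)"

definition acted_hom :: "'s set \<Rightarrow> ('s, 'm) acted_group \<Rightarrow> ('s, 'n) acted_group \<Rightarrow> ('m \<Rightarrow> 'n) set" where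
  "acted_hom S M N = {f \<in> hom M N. \<forall>s\<in>S. \<forall>x\<in>carrier M. f (act M s x) = act N s (f x)}"

lemma acted_hom_id: "(\<lambda>x. x) \<in> acted_hom S M M"
  by (simp add: acted_hom_def hom_def)

text \<open>The generating set of \<open>tensor_relations\<close> in inductive form, which provides
  introduction rules and case distinction for its three kinds of relations.\<close>

inductive_set tensor_generators ::
  "'s set \<Rightarrow> ('s, 'm) acted_group \<Rightarrow> ('s, 'n) acted_group \<Rightarrow> ('m \<times> 'n \<Rightarrow>\<^sub>0 int) set"
  for S M N where
  left: "\<lbrakk>x \<in> carrier M; x' \<in> carrier M; y \<in> carrier N\<rbrakk> \<Longrightarrow>
    frag_of (x \<otimes>\<^bsub>M\<^esub> x', y) - frag_of (x, y) - frag_of (x', y) \<in> tensor_generators S M N"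
| right: "\<lbrakk>x \<in> carrier M; y \<in> carrier N; y' \<in> carrier N\<rbrakk> \<Longrightarrow>
    frag_of (x, y \<otimes>\<^bsub>N\<^esub> y') - frag_of (x, y) - frag_of (x, y') \<in> tensor_generators S M N"
| balanced: "\<lbrakk>s \<in> S; x \<in> carrier M; y \<in> carrier N\<rbrakk> \<Longrightarrow>
    frag_of (act M s x, y) - frag_of (x, act N s y) \<in> tensor_generators S M N"

lemma tensor_relations_eq: "tensor_relations S M N = generate (tensor_free M N) (tensor_generators S M N)"
proof -
  have "tensor_generators S M N =
      {frag_of (x \<otimes>\<^bsub>M\<^esub> x', y) - frag_of (x, y) - frag_of (x', y) | x x' y.
         x \<in> carrier M \<and> x' \<in> carrier M \<and> y \<in> carrier N} \<union>
      {frag_of (x, y \<otimes>\<^bsub>N\<^esub> y') - frag_of (x, y) - frag_of (x, y') | x y y'.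
         x \<in> carrier M \<and> y \<in> carrier N \<and> y' \<in> carrier N} \<union>
      {frag_of (act M s x, y) - frag_of (x, act N s y) | s x y.
         s \<in> S \<and> x \<in> carrier M \<and> y \<in> carrier N}"
    (is "_ = ?R")
  proof (intro equalityI subsetI)
    show "q \<in> ?R" if "q \<in> tensor_generators S M N" for q
      using that by cases blast+
    show "q \<in> tensor_generators S M N" if "q \<in> ?R" for q
      using that by (elim UnE CollectE exE conjE) (simp_all add: tensor_generators.intros)
  qed
  then show ?thesis by (simp only: tensor_relations_def)
qed

lemma comm_group_tensor_free: "comm_group (tensor_free M N)"
  by (rule abelian_free_Abelian_group)

context
  fixes S :: "'s set" and M :: "('s, 'm) acted_group" and N :: "('s, 'n) acted_group"
  assumes M: "acted S M" and N: "acted S N"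
begin

lemma tensor_generators_subset: "tensor_generators S M N \<subseteq> carrier (tensor_free M N)"
proof
  interpret M: comm_group M using M by (simp add: acted_def)
  interpret N: comm_group N using N by (simp add: acted_def)
  have diff: "a - b \<in> carrier (tensor_free M N)"
    if "a \<in> carrier (tensor_free M N)" "b \<in> carrier (tensor_free M N)" for a b :: "'m \<times> 'n \<Rightarrow>\<^sub>0 int"
    using that keys_diff[of a b] by auto
  fix q assume "q \<in> tensor_generators S M N"
  then show "q \<in> carrier (tensor_free M N)"
  proof cases
    case (left x x' y)
    then show ?thesis by (simp only: left(1)) (intro diff; simp)
  next
    case (right x y y')
    then show ?thesis by (simp only: right(1)) (intro diff; simp)
  next
    case (balanced s x y)
    then show ?thesis using M N by (simp only: balanced(1)) (intro diff; simp add: acted_def)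
  qed
qed

lemma subgroup_tensor_relations: "subgroup (tensor_relations S M N) (tensor_free M N)"
  unfolding tensor_relations_eq
  by (rule group.generate_is_subgroup[OF group_free_Abelian_group tensor_generators_subset])

lemma comm_group_tensor: "comm_group (tensor S M N)"
  unfolding tensor_def by (rule comm_group.abelian_FactGroup[OF comm_group_tensor_free subgroup_tensor_relations])

lemma tensor_cases [consumes 1]:
  assumes "t \<in> carrier (tensor S M N)"
  obtains c where "c \<in> carrier (tensor_free M N)" "t = tensor_relations S M N #>\<^bsub>tensor_free M N\<^esub> c"
  using assms by (auto simp: tensor_def FactGroup_def RCOSETS_def)

end

lemma frag_extend_pair_hom:
  assumes "f \<in> hom M M'" "g \<in> hom N N'"
  shows "frag_extend (\<lambda>(x, y). frag_of (f x, g y)) \<in> hom (tensor_free M N) (tensor_free M' N')"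
proof -
  have "Poly_Mapping.keys (frag_extend (\<lambda>(x, y). frag_of (f x, g y)) c) \<subseteq> carrier M' \<times> carrier N'"
    if "Poly_Mapping.keys c \<subseteq> carrier M \<times> carrier N" for c
  proof (rule order_trans[OF keys_frag_extend], rule UN_least)
    fix q assume "q \<in> Poly_Mapping.keys c"
    with that have "q \<in> carrier M \<times> carrier N" by (rule subsetD)
    then show "Poly_Mapping.keys (case q of (x, y) \<Rightarrow> frag_of (f x, g y)) \<subseteq> carrier M' \<times> carrier N'"
      using hom_in_carrier[OF assms(1)] hom_in_carrier[OF assms(2)]
      by (cases q) (simp add: keys_frag_of)
  qed
  then show ?thesis by (simp add: hom_def frag_extend_add)
qed

context
  fixes S :: "'s set" and M :: "('s, 'm) acted_group" and N :: "('s, 'n) acted_group"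
    and M' :: "('s, 'm1) acted_group" and N' :: "('s, 'n1) acted_group" and f g
  assumes M: "acted S M" and N: "acted S N" and M': "acted S M'" and N': "acted S N'"
    and f: "f \<in> acted_hom S M M'" and g: "g \<in> acted_hom S N N'"
begin

lemma acted_homs: "f \<in> hom M M'" "g \<in> hom N N'"
  using f g by (auto simp: acted_hom_def)

text \<open>Each generating relation goes to a generating relation of the same kind, so the map of
  free groups descends to the tensor products.\<close>

lemma tensor_relations_image:
  "frag_extend (\<lambda>(x, y). frag_of (f x, g y)) ` tensor_relations S M N \<subseteq> tensor_relations S M' N'"
proof -
  let ?e = "frag_extend (\<lambda>(x, y). frag_of (f x, g y))"
  interpret h: group_hom "tensor_free M N" "tensor_free M' N'" ?e
    using frag_extend_pair_hom[OF acted_homs] by (simp add: group_hom_def group_hom_axioms_def)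
  define Q where "Q = tensor_generators S M N"
  have rel: "tensor_relations S M N = generate (tensor_free M N) Q"
    by (simp add: tensor_relations_eq Q_def)
  have Q: "Q \<subseteq> carrier (tensor_free M N)"
    unfolding Q_def by (rule tensor_generators_subset[OF M N])
  have fc: "f x \<in> carrier M'" if "x \<in> carrier M" for x using hom_in_carrier[OF acted_homs(1) that] .
  have gc: "g y \<in> carrier N'" if "y \<in> carrier N" for y using hom_in_carrier[OF acted_homs(2) that] .
  have acts: "f (act M s x) = act M' s (f x)" "g (act N s y) = act N' s (g y)"
    if "s \<in> S" "x \<in> carrier M" "y \<in> carrier N" for s x y
    using f g that by (auto simp: acted_hom_def)
  have gens: "?e q \<in> tensor_relations S M' N'" if "q \<in> Q" for q
  proof -
    have "?e q \<in> tensor_generators S M' N'"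
      using that unfolding Q_def
    proof cases
      case (left x x' y)
      then show ?thesis
        using tensor_generators.left[of "f x" M' "f x'" "g y" N' S] fc gc
        by (simp add: frag_extend_diff hom_mult[OF acted_homs(1)])
    next
      case (right x y y')
      then show ?thesis
        using tensor_generators.right[of "f x" M' "g y" N' "g y'" S] fc gc
        by (simp add: frag_extend_diff hom_mult[OF acted_homs(2)])
    next
      case (balanced s x y)
      then show ?thesis
        using tensor_generators.balanced[of s S "f x" M' "g y" N'] fc gc
        by (simp add: frag_extend_diff acts)
    qed
    then show ?thesis unfolding tensor_relations_eq by (rule generate.incl)
  qed
  have "?e q \<in> tensor_relations S M' N'" if "q \<in> generate (tensor_free M N) Q" for q
    using that
  proof (induction rule: generate.induct)
    case one
    show ?case using subgroup.one_closed[OF subgroup_tensor_relations[OF M' N']] by simp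
  next
    case (inv q)
    then have "?e (inv\<^bsub>tensor_free M N\<^esub> q) = inv\<^bsub>tensor_free M' N'\<^esub> ?e q"
      using Q by (intro h.hom_inv) blast
    then show ?case
      using subgroup.m_inv_closed[OF subgroup_tensor_relations[OF M' N'] gens[OF inv]] by simp
  next
    case (eng p q)
    then show ?case
      using subgroup.m_closed[OF subgroup_tensor_relations[OF M' N'] eng(3,4)] by (simp add: frag_extend_add)
  qed (rule gens)
  then show ?thesis unfolding rel by blast
qed

lemma tensor_map_coset:
  assumes "c \<in> carrier (tensor_free M N)"
  shows "tensor_map S M' N' f g (tensor_relations S M N #>\<^bsub>tensor_free M N\<^esub> c) =
    tensor_relations S M' N' #>\<^bsub>tensor_free M' N'\<^esub> frag_extend (\<lambda>(x, y). frag_of (f x, g y)) c"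
  unfolding tensor_map_def
  by (rule coset_map_coset[OF comm_group_tensor_free comm_group_tensor_free frag_extend_pair_hom[OF acted_homs]
        subgroup_tensor_relations[OF M N] subgroup_tensor_relations[OF M' N'] tensor_relations_image assms])

lemma tensor_map_hom: "tensor_map S M' N' f g \<in> hom (tensor S M N) (tensor S M' N')"
  unfolding tensor_map_def tensor_def
  by (rule coset_map_hom[OF comm_group_tensor_free comm_group_tensor_free frag_extend_pair_hom[OF acted_homs]
        subgroup_tensor_relations[OF M N] subgroup_tensor_relations[OF M' N'] tensor_relations_image])

end

lemma acted_hom_compose:
  "f \<in> acted_hom S M M1 \<Longrightarrow> f' \<in> acted_hom S M1 M' \<Longrightarrow> (\<lambda>x. f' (f x)) \<in> acted_hom S M M'"
  by (auto simp: acted_hom_def hom_def Pi_iff)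

text \<open>The composite enters through \<open>h\<close> and \<open>k\<close>, which agree with it
  on the carriers; two factorizations of one map can thus be compared.\<close>

lemma tensor_map_compose:
  assumes acted: "acted S M" "acted S N" "acted S M1" "acted S N1" "acted S M'" "acted S N'"
    and f: "f \<in> acted_hom S M M1" "f' \<in> acted_hom S M1 M'" and g: "g \<in> acted_hom S N N1" "g' \<in> acted_hom S N1 N'"
    and h: "h \<in> acted_hom S M M'" and k: "k \<in> acted_hom S N N'"
    and eq: "\<And>x. x \<in> carrier M \<Longrightarrow> f' (f x) = h x" "\<And>y. y \<in> carrier N \<Longrightarrow> g' (g y) = k y"
    and t: "t \<in> carrier (tensor S M N)"
  shows "tensor_map S M' N' f' g' (tensor_map S M1 N1 f g t) = tensor_map S M' N' h k t"
proof -
  obtain c where c: "c \<in> carrier (tensor_free M N)" "t = tensor_relations S M N #>\<^bsub>tensor_free M N\<^esub> c"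
    using tensor_cases[OF acted(1,2) t] .
  have "frag_extend (\<lambda>(x, y). frag_of (f' x, g' y)) (frag_extend (\<lambda>(x, y). frag_of (f x, g y)) c) =
      frag_extend (\<lambda>(x, y). frag_of (f' (f x), g' (g y))) c"
    using frag_extend_compose[of "\<lambda>(x, y). frag_of (f' x, g' y)" "\<lambda>(x, y). (f x, g y)" c]
    by (simp add: o_def case_prod_beta')
  also have "\<dots> = frag_extend (\<lambda>(x, y). frag_of (h x, k y)) c"
    by (rule frag_extend_eq) (use c(1) eq in auto)
  finally have "frag_extend (\<lambda>(x, y). frag_of (f' x, g' y)) (frag_extend (\<lambda>(x, y). frag_of (f x, g y)) c) =
      frag_extend (\<lambda>(x, y). frag_of (h x, k y)) c" .
  moreover have "frag_extend (\<lambda>(x, y). frag_of (f x, g y)) c \<in> carrier (tensor_free M1 N1)"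
    using frag_extend_pair_hom[of f M M1 g N N1] f(1) g(1) c(1) unfolding acted_hom_def by (blast intro: hom_in_carrier)
  ultimately show ?thesis
    unfolding c(2)
    by (simp only: tensor_map_coset[OF acted(1,2,3,4) f(1) g(1) c(1)] tensor_map_coset[OF acted(1,2,5,6) h k c(1)]
        tensor_map_coset[OF acted(3,4,5,6) f(2) g(2)])
qed

text \<open>Both routes equal the map induced by the composites through \<open>M2\<close> and
  \<open>N2\<close>. Used for the boundary against translations and against changes of
  coefficients.\<close>

lemma tensor_map_commute:
  assumes acted: "acted S M" "acted S N" "acted S M1" "acted S N1" "acted S M2" "acted S N2"
      "acted S M'" "acted S N'"
    and f: "f \<in> acted_hom S M M1" "f' \<in> acted_hom S M1 M'" and g: "g \<in> acted_hom S N N1" "g' \<in> acted_hom S N1 N'"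
    and h: "h \<in> acted_hom S M M2" "h' \<in> acted_hom S M2 M'" and k: "k \<in> acted_hom S N N2" "k' \<in> acted_hom S N2 N'"
    and eq: "\<And>x. x \<in> carrier M \<Longrightarrow> f' (f x) = h' (h x)" "\<And>y. y \<in> carrier N \<Longrightarrow> g' (g y) = k' (k y)"
    and t: "t \<in> carrier (tensor S M N)"
  shows "tensor_map S M' N' f' g' (tensor_map S M1 N1 f g t) = tensor_map S M' N' h' k' (tensor_map S M2 N2 h k t)"
  unfolding tensor_map_compose[OF acted(1,2,5,6,7,8) h k acted_hom_compose[OF h] acted_hom_compose[OF k] refl refl t]
  by (rule tensor_map_compose[OF acted(1,2,3,4,7,8) f g acted_hom_compose[OF h] acted_hom_compose[OF k] eq t])

lemma with_action_simps [simp]: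
  "carrier (with_action G f) = carrier G" "monoid.mult (with_action G f) = monoid.mult G"
  "\<one>\<^bsub>with_action G f\<^esub> = \<one>\<^bsub>G\<^esub>" "act (with_action G f) = f"
  by (simp_all add: with_action_def)

lemma hom_with_action [simp]: "hom (with_action G f) (with_action H g) = hom G H"
  by (simp add: hom_def)

lemma comm_group_with_action:
  assumes "comm_group G"
  shows "comm_group (with_action G f)"
proof -
  interpret comm_group G by fact
  show ?thesis
    by (rule comm_groupI) (auto simp: m_ac intro: bexI[of _ "inv\<^bsub>G\<^esub> _"])
qed

lemma acted_int_module: "comm_group G \<Longrightarrow> acted UNIV (int_module G)"
  by (simp add: acted_def int_module_def comm_group_with_action group.int_pow_closed comm_group.axioms)

lemma acted_hom_int_module:
  assumes "comm_group G" "comm_group H" "f \<in> hom G H"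
  shows "f \<in> acted_hom UNIV (int_module G) (int_module H)"
proof -
  interpret group_hom G H f
    using assms by (simp add: group_hom_def group_hom_axioms_def comm_group.axioms)
  show ?thesis
    using assms(3) by (simp add: acted_hom_def int_module_def hom_int_pow)
qed

text \<open>A group ring element acts by a finite product over its support, written
  multiplicatively; this moves the boundary inside.\<close>

lemma hom_finprod:
  assumes "comm_group G" "comm_group H" "f \<in> hom G H" "finite I" "\<And>i. i \<in> I \<Longrightarrow> u i \<in> carrier G"
  shows "f (finprod G u I) = finprod H (\<lambda>i. f (u i)) I"
proof -
  interpret G: comm_group G by fact
  interpret H: comm_group H by fact
  show ?thesis
    using assms(4,5)
  proof (induction I rule: finite_induct)
    case empty
    show ?case using hom_one[OF assms(3) G.group_axioms H.group_axioms] by simp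
  next
    case (insert i I)
    then show ?case
      using hom_in_carrier[OF assms(3)] by (subst G.finprod_insert H.finprod_insert; force simp: hom_mult[OF assms(3)])+
  qed
qed


section \<open>Twisted homology\<close>

text \<open>On cycles \<open>m r\<close> equals \<open>i\<close> after \<open>m' r\<close>, so every
  generator on the left lies in the image of the homology map of \<open>i\<close>. That image is a
  subgroup, hence contains the subgroup generated.\<close>

lemma chain_map_filtration:
  assumes T: "chain_complex T d" and T': "chain_complex T' d'"
    and i: "chain_map T' d' T d i"
    and m: "\<And>r. r \<in> Q \<Longrightarrow> chain_map T d T d (m r)" "\<And>r. r \<in> Q \<Longrightarrow> chain_map T d T' d' (m' r)"
    and factor: "\<And>r n z. r \<in> Q \<Longrightarrow> z \<in> carrier (T n) \<Longrightarrow> m r n z = i n (m' r n z)"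
  shows "generate (complex_homology T d n)
      {coset_map (T n) (complex_boundaries T d n) (m r n) h | r h. r \<in> Q \<and> h \<in> carrier (complex_homology T d n)}
    \<subseteq> coset_map (T n) (complex_boundaries T d n) (i n) ` carrier (complex_homology T' d' n)"
proof (rule group.generate_subgroup_incl)
  let ?im = "coset_map (T n) (complex_boundaries T d n) (i n) ` carrier (complex_homology T' d' n)"
  note H = comm_group_complex_homology[OF T, of n] and H' = comm_group_complex_homology[OF T', of n]
  show "Group.group (complex_homology T d n)" using H by (rule comm_group.axioms)
  show "subgroup ?im (complex_homology T d n)"
    by (rule hom_image_subgroup[OF H' H homology_map_hom[OF T' T i]])
      (rule group.subgroup_self, use H' in \<open>rule comm_group.axioms\<close>)
  have "coset_map (T n) (complex_boundaries T d n) (m r n) h \<in> ?im"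
    if r: "r \<in> Q" and h: "h \<in> carrier (complex_homology T d n)" for r h
  proof -
    obtain z where z: "z \<in> kernel (T n) (T (n - 1)) (d n)" "h = complex_boundaries T d n #>\<^bsub>T n\<^esub> z"
      using h unfolding carrier_complex_homology[OF T] by blast
    have zT: "z \<in> carrier (T n)" using z(1) by (simp add: kernel_def)
    \<comment> \<open>The lift is a cycle because \<open>m' r\<close> is itself a chain map. A cycle
      \<open>i n (m' r n z)\<close> would not imply this, as \<open>i\<close> is not assumed
      injective.\<close>
    have z': "m' r n z \<in> kernel (T' n) (T' (n - 1)) (d' n)"
      by (rule chain_map_cycles[OF T T' m(2)[OF r] z(1)])
    then have zT': "m' r n z \<in> carrier (T' n)" by (simp add: kernel_def)
    have "coset_map (T n) (complex_boundaries T d n) (m r n) h =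
        coset_map (T n) (complex_boundaries T d n) (i n) (complex_boundaries T' d' n #>\<^bsub>T' n\<^esub> m' r n z)"
      unfolding z(2) coset_map_boundaries[OF T T m(1)[OF r] zT] coset_map_boundaries[OF T' T i zT']
      by (simp only: factor[OF r zT])
    moreover have "complex_boundaries T' d' n #>\<^bsub>T' n\<^esub> m' r n z \<in> carrier (complex_homology T' d' n)"
      unfolding carrier_complex_homology[OF T'] by (rule imageI[OF z'])
    ultimately show ?thesis by (rule image_eqI)
  qed
  then show "{coset_map (T n) (complex_boundaries T d n) (m r n) h | r h.
      r \<in> Q \<and> h \<in> carrier (complex_homology T d n)} \<subseteq> ?im" by blast
qed

section \<open>Cellular chains as a module over the group ring\<close>

lemma comm_group_add_monoid: "cring K \<Longrightarrow> comm_group (add_monoid K)"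
  by (simp add: cring_def ring.is_abelian_group abelian_group.a_comm_group)

lemma mult_left_hom: "ring K \<Longrightarrow> k \<in> carrier K \<Longrightarrow> (\<lambda>b. k \<otimes>\<^bsub>K\<^esub> b) \<in> hom (add_monoid K) (add_monoid K)"
proof -
  assume "ring K" and k: "k \<in> carrier K"
  interpret ring K by fact
  show ?thesis using k by (auto simp: hom_def r_distr)
qed

context
  fixes K :: "('k, 'm) ring_scheme" and X :: "'a topology" and C :: "nat \<Rightarrow> 'a set set" and x :: 'a
  assumes K: "cring K" and x: "x \<in> topspace X"
begin

lemma ring_K: "ring K"
  using K by (simp add: cring_def)

lemma comm_group_cover_chains: "comm_group (cover_chains X C x n)"
  by (simp add: cover_chains_def)

lemma comm_group_cover_ktensor: "comm_group (cover_ktensor K X C x n)"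
  unfolding cover_ktensor_def
  by (intro comm_group_tensor acted_int_module comm_group_add_monoid K comm_group_cover_chains)

lemma int_homs:
  "f \<in> hom (add_monoid K) (add_monoid K) \<Longrightarrow> f \<in> acted_hom UNIV (int_module (add_monoid K)) (int_module (add_monoid K))"
  "h \<in> hom (cover_chains X C x n) (cover_chains X C x n') \<Longrightarrow>
    h \<in> acted_hom UNIV (int_module (cover_chains X C x n)) (int_module (cover_chains X C x n'))"
  by (intro acted_hom_int_module comm_group_add_monoid K comm_group_cover_chains; assumption)+

lemma cover_ktensor_map_hom:
  assumes "f \<in> hom (add_monoid K) (add_monoid K)" "h \<in> hom (cover_chains X C x n) (cover_chains X C x n')"
  shows "cover_ktensor_map K X C x n' f h \<in> hom (cover_ktensor K X C x n) (cover_ktensor K X C x n')"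
  unfolding cover_ktensor_def cover_ktensor_map_def
  by (intro tensor_map_hom acted_int_module comm_group_add_monoid K comm_group_cover_chains int_homs assms)

lemma id_hom: "(\<lambda>b. b) \<in> hom G G"
  by (simp add: hom_def)

lemma cover_kboundary_hom: "cover_kboundary K X C x n \<in> hom (cover_ktensor K X C x n) (cover_ktensor K X C x (n - 1))"
  unfolding cover_kboundary_def by (intro cover_ktensor_map_hom id_hom cover_boundary_hom)

lemma pi_coeff_closed:
  "a \<in> carrier (pi_ring K X x) \<Longrightarrow> g \<in> carrier (fundamental_group X x) \<Longrightarrow> a g \<in> carrier K"
  by (simp add: group_ring_def)

lemma translate_hom:
  assumes "a \<in> carrier (pi_ring K X x)" "g \<in> carrier (fundamental_group X x)"
  shows "cover_ktensor_map K X C x n (\<lambda>b. a g \<otimes>\<^bsub>K\<^esub> b) (cover_translate X C x n g)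
    \<in> hom (cover_ktensor K X C x n) (cover_ktensor K X C x n)"
  by (intro cover_ktensor_map_hom mult_left_hom ring_K pi_coeff_closed assms cover_translate_hom)

lemma carrier_cover_kchains: "carrier (cover_kchains K X C x n) = carrier (cover_ktensor K X C x n)"
  by (simp add: cover_kchains_def)

lemma acted_cover_kchains: "acted (carrier (pi_ring K X x)) (cover_kchains K X C x n)"
proof -
  interpret T: comm_group "cover_ktensor K X C x n" by (rule comm_group_cover_ktensor)
  show ?thesis
    unfolding acted_def cover_kchains_def
    by (auto intro!: comm_group_with_action T.comm_group_axioms T.finprod_closed hom_in_carrier[OF translate_hom])
qed

text \<open>The boundary is the identity on the scalar factor, and on the chain factor it commutes
  with deck transformations.\<close>

lemma cover_kboundary_translate:
  assumes a: "a \<in> carrier (pi_ring K X x)" and g: "g \<in> carrier (fundamental_group X x)"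
    and t: "t \<in> carrier (cover_ktensor K X C x n)"
  shows "cover_kboundary K X C x n (cover_ktensor_map K X C x n (\<lambda>b. a g \<otimes>\<^bsub>K\<^esub> b) (cover_translate X C x n g) t) =
    cover_ktensor_map K X C x (n - 1) (\<lambda>b. a g \<otimes>\<^bsub>K\<^esub> b) (cover_translate X C x (n - 1) g) (cover_kboundary K X C x n t)"
  unfolding cover_kboundary_def cover_ktensor_map_def
  by (rule tensor_map_commute[where M = "int_module (add_monoid K)" and N = "int_module (cover_chains X C x n)"])
    (intro acted_int_module comm_group_add_monoid K comm_group_cover_chains int_homs id_hom
      mult_left_hom ring_K pi_coeff_closed a g cover_translate_hom cover_boundary_hom refl
      cover_boundary_translate x t[unfolded cover_ktensor_def])+

text \<open>The action of \<open>a\<close> is a product over the finite support of \<open>a\<close>,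
  and the homomorphism \<open>cover_kboundary\<close> commutes with each factor.\<close>

lemma cover_kboundary_acted_hom:
  "cover_kboundary K X C x n \<in>
    acted_hom (carrier (pi_ring K X x)) (cover_kchains K X C x n) (cover_kchains K X C x (n - 1))"
proof -
  have "cover_kboundary K X C x n (act (cover_kchains K X C x n) a t) =
      act (cover_kchains K X C x (n - 1)) a (cover_kboundary K X C x n t)"
    if a: "a \<in> carrier (pi_ring K X x)" and t: "t \<in> carrier (cover_ktensor K X C x n)" for a t
  proof -
    let ?G = "{g \<in> carrier (fundamental_group X x). a g \<noteq> \<zero>\<^bsub>K\<^esub>}"
    interpret T: comm_group "cover_ktensor K X C x (n - 1)" by (rule comm_group_cover_ktensor)
    have fin: "finite ?G"
      using a by (auto simp: group_ring_def elim: rev_finite_subset)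
    show ?thesis
      unfolding cover_kchains_def with_action_simps
    proof (subst hom_finprod[OF comm_group_cover_ktensor comm_group_cover_ktensor cover_kboundary_hom fin])
      show "cover_ktensor_map K X C x n (\<lambda>b. a g \<otimes>\<^bsub>K\<^esub> b) (cover_translate X C x n g) t
          \<in> carrier (cover_ktensor K X C x n)" if "g \<in> ?G" for g
        using that hom_in_carrier[OF translate_hom[OF a] t] by simp
      have "cover_ktensor_map K X C x (n - 1) (\<lambda>b. a g \<otimes>\<^bsub>K\<^esub> b) (cover_translate X C x (n - 1) g)
          (cover_kboundary K X C x n t) \<in> carrier (cover_ktensor K X C x (n - 1))" if "g \<in> ?G" for g
        using that hom_in_carrier[OF translate_hom[OF a] hom_in_carrier[OF cover_kboundary_hom t]] by simp
      then show "(\<Otimes>\<^bsub>cover_ktensor K X C x (n - 1)\<^esub>g\<in>?G. cover_kboundary K X C x n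
            (cover_ktensor_map K X C x n (\<lambda>b. a g \<otimes>\<^bsub>K\<^esub> b) (cover_translate X C x n g) t)) =
          (\<Otimes>\<^bsub>cover_ktensor K X C x (n - 1)\<^esub>g\<in>?G. cover_ktensor_map K X C x (n - 1)
            (\<lambda>b. a g \<otimes>\<^bsub>K\<^esub> b) (cover_translate X C x (n - 1) g) (cover_kboundary K X C x n t))"
        using cover_kboundary_translate[OF a _ t] by (intro T.finprod_cong' refl) auto
    qed
  qed
  then show ?thesis
    using cover_kboundary_hom unfolding acted_hom_def carrier_cover_kchains
    by (auto simp: cover_kchains_def)
qed

section \<open>Change of coefficients and comparison of the filtrations\<close>

context
  fixes R :: "('r, 'p) ring_scheme" and \<rho> :: "((real \<Rightarrow> 'a) set \<Rightarrow> 'k) \<Rightarrow> 'r"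
begin

lemma chain_complex_twisted:
  assumes A: "acted (carrier (pi_ring K X x)) (right_module_via R \<rho> A)"
  shows "chain_complex (twisted_chains K X C x R \<rho> A) (twisted_boundary K X C x R \<rho> A)"
  unfolding chain_complex_def twisted_chains_def twisted_boundary_def
  by (intro allI conjI comm_group_tensor tensor_map_hom A acted_cover_kchains acted_hom_id cover_kboundary_acted_hom)

text \<open>\<open>f\<close> acts on the coefficient factor and the boundary on the chain factor, so
  they commute.\<close>

lemma chain_map_twisted:
  assumes A: "acted (carrier (pi_ring K X x)) (right_module_via R \<rho> A)"
    and B: "acted (carrier (pi_ring K X x)) (right_module_via R \<rho> B)"
    and f: "f \<in> acted_hom (carrier (pi_ring K X x)) (right_module_via R \<rho> A) (right_module_via R \<rho> B)"
  shows "chain_map (twisted_chains K X C x R \<rho> A) (twisted_boundary K X C x R \<rho> A)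
    (twisted_chains K X C x R \<rho> B) (twisted_boundary K X C x R \<rho> B)
    (\<lambda>n. tensor_map (carrier (pi_ring K X x)) (right_module_via R \<rho> B) (cover_kchains K X C x n) f (\<lambda>c. c))"
  unfolding chain_map_def twisted_chains_def twisted_boundary_def
proof (intro allI conjI ballI)
  fix n t
  show "tensor_map (carrier (pi_ring K X x)) (right_module_via R \<rho> B) (cover_kchains K X C x n) f (\<lambda>c. c)
      \<in> hom (tensor (carrier (pi_ring K X x)) (right_module_via R \<rho> A) (cover_kchains K X C x n))
            (tensor (carrier (pi_ring K X x)) (right_module_via R \<rho> B) (cover_kchains K X C x n))"
    by (intro tensor_map_hom A B f acted_cover_kchains acted_hom_id)
  assume t: "t \<in> carrier (tensor (carrier (pi_ring K X x)) (right_module_via R \<rho> A) (cover_kchains K X C x n))"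
  show "tensor_map (carrier (pi_ring K X x)) (right_module_via R \<rho> B) (cover_kchains K X C x (n - 1))
       (\<lambda>r. r) (cover_kboundary K X C x n)
       (tensor_map (carrier (pi_ring K X x)) (right_module_via R \<rho> B) (cover_kchains K X C x n) f (\<lambda>c. c) t) =
      tensor_map (carrier (pi_ring K X x)) (right_module_via R \<rho> B) (cover_kchains K X C x (n - 1)) f (\<lambda>c. c)
       (tensor_map (carrier (pi_ring K X x)) (right_module_via R \<rho> A) (cover_kchains K X C x (n - 1))
       (\<lambda>r. r) (cover_kboundary K X C x n) t)"
    by (rule tensor_map_commute[OF A acted_cover_kchains B acted_cover_kchains A acted_cover_kchains B
          acted_cover_kchains f acted_hom_id acted_hom_id cover_kboundary_acted_hom acted_hom_id f
          cover_kboundary_acted_hom acted_hom_id refl refl t])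
qed

text \<open>Absorption on the right closes \<open>A\<close> under
  \<open>r \<mapsto> r \<rho>(a)\<close>; two-sidedness of \<open>R I\<^sup>k\<close> is used here
  once more.\<close>

lemma acted_right_module_via:
  assumes R: "ring R" and "\<rho> \<in> ring_hom (pi_ring K X x) R" and A: "ideal A R"
  shows "acted (carrier (pi_ring K X x)) (right_module_via R \<rho> A)"
proof -
  interpret R: ring R by fact
  have "comm_group ((add_monoid R)\<lparr>carrier := A\<rparr>)"
    by (rule comm_group_subgroup[OF R.a_comm_group additive_subgroup.a_subgroup[OF ideal.axioms(1)[OF A]]])
  then show ?thesis
    using ideal.I_r_closed[OF A] ring_hom_closed[OF assms(2)]
    by (simp add: acted_def right_module_via_def comm_group_with_action)
qed

text \<open>The common part of both cases: they enter only through \<open>swap\<close>. The maps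
  \<open>m r\<close> and \<open>m' r\<close> of \<open>chain_map_filtration\<close> are both induced
  by left multiplication by \<open>r\<close>, with coefficients in \<open>R\<close> and in
  \<open>R I\<^sup>k\<close> as targets, and \<open>i\<close> is induced by the inclusion.\<close>

lemma J_adic_subset_I_adic:
  assumes R: "ring R" and \<rho>: "\<rho> \<in> ring_hom (pi_ring K X x) R"
    and swap: "\<And>L a s. ideal L (pi_ring K X x) \<Longrightarrow> a \<in> L \<Longrightarrow> s \<in> carrier R \<Longrightarrow>
      \<exists>a'\<in>L. \<exists>t\<in>carrier R. \<rho> a \<otimes>\<^bsub>R\<^esub> s = t \<otimes>\<^bsub>R\<^esub> \<rho> a'"
  shows "J_adic_filtration K X C x R \<rho> k n \<subseteq> I_adic_filtration K X C x R \<rho> k n"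
proof -
  interpret P: group_algebra K "fundamental_group X x"
    using K group_fundamental_group[OF x] by (simp add: group_algebra_def)
  interpret R: ring R by fact
  interpret E: extension_of_ideals "pi_ring K X x" R \<rho>
    using P.ring_group_ring R \<rho> swap by (simp add: extension_of_ideals_def extension_of_ideals_axioms_def)
  let ?I = "augmentation_ideal K (fundamental_group X x)"
  let ?A = "span_ideal_power K X x R \<rho> k"
  let ?S = "carrier (pi_ring K X x)"
  have A: "?A = E.extension (ideal_power (pi_ring K X x) ?I k)"
    by (simp add: span_ideal_power_def E.extension_def)
  have idealA: "ideal ?A R"
    unfolding A by (rule E.ideal_extension[OF E.P.ideal_power_ideal[OF P.augmentation_ideal_ideal]])
  have actA: "acted ?S (right_module_via R \<rho> ?A)"
    by (rule acted_right_module_via[OF R \<rho> idealA])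
  have actR: "acted ?S (right_module_via R \<rho> (carrier R))"
    by (rule acted_right_module_via[OF R \<rho> R.oneideal])
  have subA: "?A \<subseteq> carrier R" using ideal.Icarr[OF idealA] by blast
  have incl: "(\<lambda>r. r) \<in> acted_hom ?S (right_module_via R \<rho> ?A) (right_module_via R \<rho> (carrier R))"
    using subA by (auto simp: acted_hom_def right_module_via_def hom_def)
  let ?Q = "ideal_power R (extended_ideal K X x R \<rho>) k"
  have idealQ: "ideal ?Q R"
    unfolding extended_ideal_def
    using ring_hom_closed[OF \<rho>] ideal.Icarr[OF P.augmentation_ideal_ideal]
    by (intro R.ideal_power_ideal R.genideal_ideal) blast
  \<comment> \<open>\<open>B\<close> stays free because it is taken to be both \<open>R\<close> and
    \<open>R I\<^sup>k\<close>. Linearity over the group ring is associativity,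
    \<open>r (s \<rho>(a)) = (r s) \<rho>(a)\<close>.\<close>
  have times: "(\<lambda>s. r \<otimes>\<^bsub>R\<^esub> s) \<in> acted_hom ?S (right_module_via R \<rho> (carrier R)) (right_module_via R \<rho> B)"
    if r: "r \<in> ?Q" and B: "\<And>s. s \<in> carrier R \<Longrightarrow> r \<otimes>\<^bsub>R\<^esub> s \<in> B" for r B
    using ideal.Icarr[OF idealQ r] B ring_hom_closed[OF \<rho>]
    by (auto simp: acted_hom_def right_module_via_def hom_def R.r_distr R.m_assoc)
  have mult: "r \<otimes>\<^bsub>R\<^esub> s \<in> ?A" if "r \<in> ?Q" "s \<in> carrier R" for r s
    using E.ideal_power_times_subset[OF P.augmentation_ideal_ideal, of r k s] that
    by (simp add: A extended_ideal_def)
  have multR: "r \<otimes>\<^bsub>R\<^esub> s \<in> carrier R" if "r \<in> ?Q" "s \<in> carrier R" for r s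
    using mult[OF that] subA by blast
  let ?m = "\<lambda>B r n. tensor_map ?S (right_module_via R \<rho> B) (cover_kchains K X C x n) (\<lambda>s. r \<otimes>\<^bsub>R\<^esub> s) (\<lambda>c. c)"
  show ?thesis
    unfolding J_adic_filtration_def I_adic_filtration_def twisted_homology_map_def twisted_homology_def
  proof (rule chain_map_filtration[where m = "?m (carrier R)" and m' = "?m ?A" and n = n and Q = ?Q
        and i = "\<lambda>n. tensor_map ?S (right_module_via R \<rho> (carrier R)) (cover_kchains K X C x n) (\<lambda>r. r) (\<lambda>c. c)"])
    fix r n z
    assume r: "r \<in> ?Q" and z: "z \<in> carrier (twisted_chains K X C x R \<rho> (carrier R) n)"
    show "?m (carrier R) r n z =
        tensor_map ?S (right_module_via R \<rho> (carrier R)) (cover_kchains K X C x n) (\<lambda>r. r) (\<lambda>c. c) (?m ?A r n z)"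
      by (rule tensor_map_compose[symmetric, OF actR acted_cover_kchains actA acted_cover_kchains actR
            acted_cover_kchains _ incl acted_hom_id acted_hom_id _ acted_hom_id refl refl
            z[unfolded twisted_chains_def]])
        (use times[OF r mult[OF r]] times[OF r multR[OF r]] in auto)
  qed (intro chain_complex_twisted chain_map_twisted actA actR incl times mult multR; assumption)+
qed

end

end

theorem corollary6p7:
  fixes K :: "('k, 'm) ring_scheme"
    and X :: "'a topology" and C :: "nat \<Rightarrow> 'a set set" and x :: 'a
    and R :: "('r, 'p) ring_scheme" and \<rho> :: "((real \<Rightarrow> 'a) set \<Rightarrow> 'k) \<Rightarrow> 'r"
    and G :: "('g, 'q) monoid_scheme" and \<nu> :: "(real \<Rightarrow> 'a) set \<Rightarrow> 'g"
  assumes "cring K"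
    and "cw_complex X C" and "connected_space X" and "C 0 = {{x}}"
  shows
    "(cring R \<and> \<rho> \<in> ring_hom (group_ring K (fundamental_group X x)) R \<longrightarrow>
       (\<forall>k n. J_adic_filtration K X C x R \<rho> k n \<subseteq> I_adic_filtration K X C x R \<rho> k n)) \<and>
     (group G \<and> \<nu> \<in> epi (fundamental_group X x) G \<longrightarrow>
       (\<forall>k n. J_adic_filtration K X C x (group_ring K G)
                 (linear_extension K (fundamental_group X x) \<nu>) k n
            \<subseteq> I_adic_filtration K X C x (group_ring K G)
                 (linear_extension K (fundamental_group X x) \<nu>) k n))"
proof (intro conjI impI allI; elim conjE)
  \<comment> \<open>\<open>C 0 = {{x}}\<close> makes the base point a cell, hence a point of
    \<open>X\<close>; the fundamental group and the deck transformations require this.\<close>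
  have x: "x \<in> topspace X"
    using assms(2,4) by (auto simp: cw_complex_def)
  {
    fix k n assume R: "cring R" and \<rho>: "\<rho> \<in> ring_hom (pi_ring K X x) R"
    interpret R: cring R by fact
    show "J_adic_filtration K X C x R \<rho> k n \<subseteq> I_adic_filtration K X C x R \<rho> k n"
    proof (rule J_adic_subset_I_adic[OF assms(1) x R.ring_axioms \<rho>])
      fix L a s assume "ideal L (pi_ring K X x)" "a \<in> L" "s \<in> carrier R"
      \<comment> \<open>By commutativity, \<open>a' = a\<close> and \<open>t = s\<close> will
        do.\<close>
      then show "\<exists>a'\<in>L. \<exists>t\<in>carrier R. \<rho> a \<otimes>\<^bsub>R\<^esub> s = t \<otimes>\<^bsub>R\<^esub> \<rho> a'"
        using ring_hom_closed[OF \<rho>] ideal.Icarr by (metis R.m_comm)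
    qed
  next
    fix k n assume G: "group G" and \<nu>: "\<nu> \<in> epi (fundamental_group X x) G"
    interpret group_algebra_hom K "fundamental_group X x" G \<nu>
      using assms(1) G \<nu> group_fundamental_group[OF x]
      by (simp add: group_algebra_hom_def group_algebra_hom_axioms_def group_algebra_def epi_def)
    let ?\<rho> = "linear_extension K (fundamental_group X x) \<nu>"
    show "J_adic_filtration K X C x (group_ring K G) ?\<rho> k n \<subseteq> I_adic_filtration K X C x (group_ring K G) ?\<rho> k n"
    proof (rule J_adic_subset_I_adic[OF assms(1) x H.ring_group_ring linear_extension_hom])
      fix L a s assume L: "ideal L (pi_ring K X x)" "a \<in> L" and s: "s \<in> carrier (group_ring K G)"
      obtain b where b: "b \<in> carrier (pi_ring K X x)" "s = ?\<rho> b"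
        using s \<nu> linear_extension_surj unfolding epi_def by blast
      note hm = linear_extension_hom and Lc = ideal.Icarr[OF L]
      \<comment> \<open>With \<open>s\<close> the image of \<open>b\<close>, the witnesses are
        \<open>a' = a b\<close>, which stays in \<open>L\<close> by absorption on the right, and
        \<open>t = 1\<close>.\<close>
      have "a \<otimes>\<^bsub>pi_ring K X x\<^esub> b \<in> L"
        using L b by (simp add: ideal.I_r_closed)
      moreover have "?\<rho> a \<otimes>\<^bsub>group_ring K G\<^esub> s =
          \<one>\<^bsub>group_ring K G\<^esub> \<otimes>\<^bsub>group_ring K G\<^esub> ?\<rho> (a \<otimes>\<^bsub>pi_ring K X x\<^esub> b)"
        using hm Lc b by (simp add: ring_hom_mult ring_hom_closed ring.ring_simprules(5,12)[OF H.ring_group_ring])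
      ultimately show "\<exists>a'\<in>L. \<exists>t\<in>carrier (group_ring K G).
          ?\<rho> a \<otimes>\<^bsub>group_ring K G\<^esub> s = t \<otimes>\<^bsub>group_ring K G\<^esub> ?\<rho> a'"
        using ring.ring_simprules(6)[OF H.ring_group_ring] by blast
    qed
  }
qed

end
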